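(* Let $M$ be a semi-invariant $\xi^{\bot}$-submanifold of a generalized Quasi-Sasakian (G.Q.S.) manifold $\widetilde{M}$. Then the distribution $\mathcal{D}$ is integrable if and only if $$h(tX,Y)-h(X,tY)=(\mathcal{L}_{\xi}\tilde g)(X,\phi Y)\,\xi\quad\text{for all } X,Y\in\Gamma(\mathcal{D}).$$
   Context: All manifolds and maps are smooth; $\Gamma(E)$ denotes the sections of a vector bundle $E$. An almost contact metric structure on a real $(2n+1)$-dimensional manifold $\widetilde{M}$ is $(\phi,\xi,\eta,\tilde g)$, where $\phi$ is a $(1,1)$-tensor field, $\xi$ a vector field, $\eta$ a 1-form and $\tilde g$ a Riemannian metric with $\phi^2=-I+\eta\otimes\xi$, $\eta(\xi)=1$, $\eta\circ\phi=0$, $\phi\xi=0$, $\eta(X)=\tilde g(X,\xi)$, $\tilde g(\phi X,Y)+\tilde g(X,\phi Y)=0$ for all vector fields $X,Y$. Let $\widetilde\nabla$ be the Levi-Civita connection of $\tilde g$. $\widetilde M$ is a generalized Quasi-Sasakian (G.Q.S.) manifold if $(\widetilde\nabla_X\phi)Y=\tilde g(\widetilde\nabla_{\phi X}\xi,Y)\xi-\eta(Y)\widetilde\nabla_{\phi X}\xi$ for all vector fields $X,Y$ on $\widetilde M$. A semi-invariant $\xi^{\bot}$-submanifold of $\widetilde M$ is an isometrically immersed submanifold $M$ such that $\xi$ is orthogonal to $M$ and there exist two orthogonal distributions $\mathcal{D},\mathcal{D}^{\bot}$ in $TM$ with $TM=\mathcal{D}\oplus\mathcal{D}^{\bot}$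 (orthogonal sum), $\phi\mathcal{D}=\mathcal{D}$ and $\phi\mathcal{D}^{\bot}\subseteq TM^{\bot}$, where $TM^{\bot}$ is the normal bundle. $h$ is the second fundamental form of $M$ in $\widetilde M$ ($\widetilde\nabla_XY=\nabla_XY+h(X,Y)$, with $\nabla$ the Levi-Civita connection of the induced metric). For $X\in\Gamma(TM)$ write $\phi X=tX+\omega X$ with $tX\in\Gamma(\mathcal{D})$ and $\omega X\in\Gamma(TM^{\bot})$. $\mathcal{L}_\xi$ is the Lie derivative along $\xi$ on $\widetilde M$. *)

theory Defs
  imports "HOL-Analysis.Analysis"
begin

section \<open>Smooth maps between open subsets of Euclidean spaces\<close>

(* Both predicates are meant for open S; there they say that f is C^k, respectively C^infinity. *)

primrec ck_on :: "nat \<Rightarrow> 'a::euclidean_space set \<Rightarrow> ('a \<Rightarrow> 'b::euclidean_space) \<Rightarrow> bool" where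
  "ck_on 0 S f \<longleftrightarrow> continuous_on S f"
| "ck_on (Suc k) S f \<longleftrightarrow>
     (\<exists>f'. (\<forall>x\<in>S. (f has_derivative f' x) (at x)) \<and> (\<forall>v. ck_on k S (\<lambda>x. f' x v)))"

definition smooth_on :: "'a::euclidean_space set \<Rightarrow> ('a \<Rightarrow> 'b::euclidean_space) \<Rightarrow> bool" where
  "smooth_on S f \<longleftrightarrow> (\<forall>k. ck_on k S f)"


section \<open>Manifolds\<close>

(* A manifold is a Hausdorff second countable type with a smooth atlas; the dimension is the
   dimension of the model space 'a. The atlas need not be maximal: no notion below changes when
   compatible charts are added. *)

type_synonym ('m, 'a) chart = "'m set \<times> ('m \<Rightarrow> 'a)"
type_synonym ('m, 'a) atlas = "('m, 'a) chart set"

abbreviation cdom :: "('m, 'a) chart \<Rightarrow> 'm set" where "cdom c \<equiv> fst c"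
abbreviation cmap :: "('m, 'a) chart \<Rightarrow> 'm \<Rightarrow> 'a" where "cmap c \<equiv> snd c"
abbreviation cinv :: "('m, 'a) chart \<Rightarrow> 'a \<Rightarrow> 'm" where "cinv c \<equiv> inv_into (cdom c) (cmap c)"

definition is_chart :: "('m::topological_space, 'a::euclidean_space) chart \<Rightarrow> bool" where
  "is_chart c \<longleftrightarrow> open (cdom c) \<and> open (cmap c ` cdom c) \<and>
     homeomorphism (cdom c) (cmap c ` cdom c) (cmap c) (cinv c)"

definition smooth_atlas ::
    "('m::{t2_space, second_countable_topology}, 'a::euclidean_space) atlas \<Rightarrow> bool" where
  "smooth_atlas A \<longleftrightarrow> (\<forall>c\<in>A. is_chart c) \<and> (\<Union>c\<in>A. cdom c) = UNIV \<and>
     (\<forall>c\<in>A. \<forall>d\<in>A. smooth_on (cmap c ` (cdom c \<inter> cdom d)) (cmap d \<circ> cinv c))"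


section \<open>Tangent vectors and vector fields\<close>

(* The tangent space at p is the model space 'a: a tangent vector is given by its components in a
   preferred chart around p. Components in the other charts are obtained with the Jacobian of the
   transition map. *)

definition chart_at :: "('m, 'a) atlas \<Rightarrow> 'm \<Rightarrow> ('m, 'a) chart" where
  "chart_at A p = (SOME c. c \<in> A \<and> p \<in> cdom c)"

definition coord_change ::
    "('m, 'a::euclidean_space) chart \<Rightarrow> ('m, 'a) chart \<Rightarrow> 'm \<Rightarrow> 'a \<Rightarrow> 'a" where
  "coord_change c d p = frechet_derivative (cmap d \<circ> cinv c) (at (cmap c p))"

(* components in the chart c of the tangent vector v at p *)
definition tcoord ::
    "('m, 'a::euclidean_space) atlas \<Rightarrow> ('m, 'a) chart \<Rightarrow> 'm \<Rightarrow> 'a \<Rightarrow> 'a" where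
  "tcoord A c p v = coord_change (chart_at A p) c p v"

(* the vector field on cdom c with constant components w in the chart c *)
definition coord_field ::
    "('m, 'a::euclidean_space) atlas \<Rightarrow> ('m, 'a) chart \<Rightarrow> 'a \<Rightarrow> 'm \<Rightarrow> 'a" where
  "coord_field A c w p = coord_change c (chart_at A p) p w"

(* a vector field X, read in the chart c *)
definition field_rep ::
    "('m, 'a::euclidean_space) atlas \<Rightarrow> ('m, 'a) chart \<Rightarrow> ('m \<Rightarrow> 'a) \<Rightarrow> 'a \<Rightarrow> 'a" where
  "field_rep A c X x = tcoord A c (cinv c x) (X (cinv c x))"

(* smoothness on an open set U of real functions and of vector fields; the values outside U
   are irrelevant *)
definition smooth_fun ::
    "('m, 'a::euclidean_space) atlas \<Rightarrow> 'm set \<Rightarrow> ('m \<Rightarrow> real) \<Rightarrow> bool" where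
  "smooth_fun A U u \<longleftrightarrow> (\<forall>c\<in>A. smooth_on (cmap c ` (U \<inter> cdom c)) (u \<circ> cinv c))"

definition smooth_field ::
    "('m, 'a::euclidean_space) atlas \<Rightarrow> 'm set \<Rightarrow> ('m \<Rightarrow> 'a) \<Rightarrow> bool" where
  "smooth_field A U X \<longleftrightarrow> (\<forall>c\<in>A. smooth_on (cmap c ` (U \<inter> cdom c)) (field_rep A c X))"

abbreviation vector_field ::
    "('m, 'a::euclidean_space) atlas \<Rightarrow> ('m \<Rightarrow> 'a) \<Rightarrow> bool" where
  "vector_field A X \<equiv> smooth_field A UNIV X"

(* the derivative v(u) of the function u along the tangent vector v at p *)
definition dir_deriv ::
    "('m, 'a::euclidean_space) atlas \<Rightarrow> 'm \<Rightarrow> 'a \<Rightarrow> ('m \<Rightarrow> real) \<Rightarrow> real" where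
  "dir_deriv A p v u =
     frechet_derivative (u \<circ> cinv (chart_at A p)) (at (cmap (chart_at A p) p)) v"

definition lie_bracket ::
    "('m, 'a::euclidean_space) atlas \<Rightarrow> ('m \<Rightarrow> 'a) \<Rightarrow> ('m \<Rightarrow> 'a) \<Rightarrow> 'm \<Rightarrow> 'a" where
  "lie_bracket A X Y p =
     (let c = chart_at A p; x = cmap c p in
        frechet_derivative (field_rep A c Y) (at x) (X p)
        - frechet_derivative (field_rep A c X) (at x) (Y p))"


section \<open>Riemannian metrics, the Levi-Civita connection and the Lie derivative of a metric\<close>

type_synonym ('m, 'a) metric_tensor = "'m \<Rightarrow> 'a \<Rightarrow> 'a \<Rightarrow> real"

definition riemannian_metric ::
    "('m::topological_space, 'a::euclidean_space) atlas \<Rightarrow> ('m, 'a) metric_tensor \<Rightarrow> bool" where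
  "riemannian_metric A g \<longleftrightarrow>
     (\<forall>p. bilinear (g p) \<and> (\<forall>v w. g p v w = g p w v) \<and> (\<forall>v. v \<noteq> 0 \<longrightarrow> 0 < g p v v)) \<and>
     (\<forall>U X Y. open U \<longrightarrow> smooth_field A U X \<longrightarrow> smooth_field A U Y \<longrightarrow>
        smooth_fun A U (\<lambda>p. g p (X p) (Y p)))"

(* nabla p v Y is the covariant derivative along the tangent vector v at p of a vector field Y that
   is smooth on some open neighbourhood U of p. The product rule, applied to functions that are 1
   on U and 0 elsewhere, shows that the values of Y outside U do not matter. *)
type_synonym ('m, 'a) conn = "'m \<Rightarrow> 'a \<Rightarrow> ('m \<Rightarrow> 'a) \<Rightarrow> 'a"

definition affine_connection ::
    "('m::topological_space, 'a::euclidean_space) atlas \<Rightarrow> ('m, 'a) conn \<Rightarrow> bool" where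
  "affine_connection A nabla \<longleftrightarrow>
     (\<forall>U. open U \<longrightarrow>
        (\<forall>Y. smooth_field A U Y \<longrightarrow> (\<forall>p\<in>U. linear (\<lambda>v. nabla p v Y))) \<and>
        (\<forall>Y Z. smooth_field A U Y \<longrightarrow> smooth_field A U Z \<longrightarrow>
           (\<forall>p\<in>U. \<forall>v. nabla p v (\<lambda>q. Y q + Z q) = nabla p v Y + nabla p v Z)) \<and>
        (\<forall>u Y. smooth_fun A U u \<longrightarrow> smooth_field A U Y \<longrightarrow>
           (\<forall>p\<in>U. \<forall>v. nabla p v (\<lambda>q. u q *\<^sub>R Y q)
              = dir_deriv A p v u *\<^sub>R Y p + u p *\<^sub>R nabla p v Y)) \<and>
        (\<forall>X Y. smooth_field A U X \<longrightarrow> smooth_field A U Y \<longrightarrow>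
           smooth_field A U (\<lambda>p. nabla p (X p) Y)))"

definition levi_civita ::
    "('m::topological_space, 'a::euclidean_space) atlas \<Rightarrow> ('m, 'a) metric_tensor \<Rightarrow>
     ('m, 'a) conn \<Rightarrow> bool" where
  "levi_civita A g nabla \<longleftrightarrow> affine_connection A nabla \<and>
     (\<forall>U X Y. open U \<longrightarrow> smooth_field A U X \<longrightarrow> smooth_field A U Y \<longrightarrow>
        (\<forall>p\<in>U. nabla p (X p) Y - nabla p (Y p) X = lie_bracket A X Y p) \<and>
        (\<forall>p\<in>U. \<forall>v. dir_deriv A p v (\<lambda>q. g q (X q) (Y q))
           = g p (nabla p v X) (Y p) + g p (X p) (nabla p v Y)))"

definition lie_deriv_fields ::
    "('m, 'a::euclidean_space) atlas \<Rightarrow> ('m \<Rightarrow> 'a) \<Rightarrow> ('m, 'a) metric_tensor \<Rightarrow>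
     ('m \<Rightarrow> 'a) \<Rightarrow> ('m \<Rightarrow> 'a) \<Rightarrow> 'm \<Rightarrow> real" where
  "lie_deriv_fields A Z g X Y p =
     dir_deriv A p (Z p) (\<lambda>q. g q (X q) (Y q))
     - g p (lie_bracket A Z X p) (Y p) - g p (X p) (lie_bracket A Z Y p)"

(* The expression above is tensorial in X and Y, so on tangent vectors v, w at p the Lie derivative
   of g along Z may be computed from any extensions; we take those with constant components. *)
definition lie_deriv_metric ::
    "('m, 'a::euclidean_space) atlas \<Rightarrow> ('m \<Rightarrow> 'a) \<Rightarrow> ('m, 'a) metric_tensor \<Rightarrow>
     ('m, 'a) metric_tensor" where
  "lie_deriv_metric A Z g p v w =
     lie_deriv_fields A Z g (coord_field A (chart_at A p) v) (coord_field A (chart_at A p) w) p"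


section \<open>Generalized quasi-Sasakian manifolds\<close>

definition almost_contact_metric ::
    "('m::topological_space, 'a::euclidean_space) atlas \<Rightarrow> ('m \<Rightarrow> 'a \<Rightarrow> 'a) \<Rightarrow> ('m \<Rightarrow> 'a) \<Rightarrow>
     ('m \<Rightarrow> 'a \<Rightarrow> real) \<Rightarrow> ('m, 'a) metric_tensor \<Rightarrow> bool" where
  "almost_contact_metric A \<phi> \<xi> \<eta> g \<longleftrightarrow>
     (\<forall>p. linear (\<phi> p)) \<and>
     (\<forall>U X. open U \<longrightarrow> smooth_field A U X \<longrightarrow> smooth_field A U (\<lambda>p. \<phi> p (X p))) \<and>
     vector_field A \<xi> \<and>
     (\<forall>p. linear (\<eta> p)) \<and>
     (\<forall>U X. open U \<longrightarrow> smooth_field A U X \<longrightarrow> smooth_fun A U (\<lambda>p. \<eta> p (X p))) \<and>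
     riemannian_metric A g \<and>
     (\<forall>p v. \<phi> p (\<phi> p v) = - v + \<eta> p v *\<^sub>R \<xi> p) \<and>
     (\<forall>p. \<eta> p (\<xi> p) = 1) \<and>
     (\<forall>p v. \<eta> p (\<phi> p v) = 0) \<and>
     (\<forall>p. \<phi> p (\<xi> p) = 0) \<and>
     (\<forall>p v. \<eta> p v = g p v (\<xi> p)) \<and>
     (\<forall>p v w. g p (\<phi> p v) w + g p v (\<phi> p w) = 0)"

definition generalized_quasi_sasakian ::
    "('m::topological_space, 'a::euclidean_space) atlas \<Rightarrow> ('m \<Rightarrow> 'a \<Rightarrow> 'a) \<Rightarrow> ('m \<Rightarrow> 'a) \<Rightarrow>
     ('m \<Rightarrow> 'a \<Rightarrow> real) \<Rightarrow> ('m, 'a) metric_tensor \<Rightarrow> ('m, 'a) conn \<Rightarrow> bool" where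
  "generalized_quasi_sasakian A \<phi> \<xi> \<eta> g nabla \<longleftrightarrow>
     almost_contact_metric A \<phi> \<xi> \<eta> g \<and> levi_civita A g nabla \<and>
     (\<forall>X Y. vector_field A X \<longrightarrow> vector_field A Y \<longrightarrow>
        (\<forall>p. nabla p (X p) (\<lambda>q. \<phi> q (Y q)) - \<phi> p (nabla p (X p) Y)
           = g p (nabla p (\<phi> p (X p)) \<xi>) (Y p) *\<^sub>R \<xi> p
             - \<eta> p (Y p) *\<^sub>R nabla p (\<phi> p (X p)) \<xi>))"


section \<open>Immersed submanifolds\<close>

(* Throughout, B is the atlas of the submanifold, A that of the ambient manifold, and f the map
   from the submanifold to the ambient manifold. *)

definition smooth_map ::
    "('n::topological_space, 'b::euclidean_space) atlas \<Rightarrow>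
     ('m::topological_space, 'a::euclidean_space) atlas \<Rightarrow> ('n \<Rightarrow> 'm) \<Rightarrow> bool" where
  "smooth_map B A f \<longleftrightarrow> continuous_on UNIV f \<and>
     (\<forall>c\<in>B. \<forall>d\<in>A. smooth_on (cmap c ` (cdom c \<inter> f -` cdom d)) (cmap d \<circ> f \<circ> cinv c))"

definition tangent_map ::
    "('n, 'b::euclidean_space) atlas \<Rightarrow> ('m, 'a::euclidean_space) atlas \<Rightarrow> ('n \<Rightarrow> 'm) \<Rightarrow>
     'n \<Rightarrow> 'b \<Rightarrow> 'a" where
  "tangent_map B A f p =
     frechet_derivative (cmap (chart_at A (f p)) \<circ> f \<circ> cinv (chart_at B p))
       (at (cmap (chart_at B p) p))"

definition immersion ::
    "('n::topological_space, 'b::euclidean_space) atlas \<Rightarrow>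
     ('m::topological_space, 'a::euclidean_space) atlas \<Rightarrow> ('n \<Rightarrow> 'm) \<Rightarrow> bool" where
  "immersion B A f \<longleftrightarrow> smooth_map B A f \<and> (\<forall>p. inj (tangent_map B A f p))"

definition induced_metric ::
    "('n, 'b::euclidean_space) atlas \<Rightarrow> ('m, 'a::euclidean_space) atlas \<Rightarrow> ('n \<Rightarrow> 'm) \<Rightarrow>
     ('m, 'a) metric_tensor \<Rightarrow> ('n, 'b) metric_tensor" where
  "induced_metric B A f g p v w = g (f p) (tangent_map B A f p v) (tangent_map B A f p w)"

definition normal_vec ::
    "('n, 'b::euclidean_space) atlas \<Rightarrow> ('m, 'a::euclidean_space) atlas \<Rightarrow> ('n \<Rightarrow> 'm) \<Rightarrow>
     ('m, 'a) metric_tensor \<Rightarrow> 'n \<Rightarrow> 'a \<Rightarrow> bool" where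
  "normal_vec B A f g p w \<longleftrightarrow> (\<forall>v. g (f p) w (tangent_map B A f p v) = 0)"

(* The ambient covariant derivative, along v tangent to the submanifold at p, of a vector field V
   along f (V q is a tangent vector at f q). With E_b the coordinate fields of the chart at f p and
   V = sum_b V_b E_b near p, it is the sum of v(V_b) E_b and V_b nabla_{f_* v} E_b. For
   V q = Z (f q) with a vector field Z it is nabla_{f_* v} Z, which is the usual
   meaning of nabla_X Y for X and Y tangent to the submanifold. *)
definition nabla_along ::
    "('n, 'b::euclidean_space) atlas \<Rightarrow> ('m, 'a::euclidean_space) atlas \<Rightarrow> ('n \<Rightarrow> 'm) \<Rightarrow>
     ('m, 'a) conn \<Rightarrow> 'n \<Rightarrow> 'b \<Rightarrow> ('n \<Rightarrow> 'a) \<Rightarrow> 'a" where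
  "nabla_along B A f nabla p v V =
     (let c = chart_at B p; d = chart_at A (f p) in
        frechet_derivative (\<lambda>x. tcoord A d (f (cinv c x)) (V (cinv c x))) (at (cmap c p)) v
        + (\<Sum>b\<in>Basis. (V p \<bullet> b) *\<^sub>R nabla (f p) (tangent_map B A f p v) (coord_field A d b)))"

(* h(X,Y), as defined by the Gauss formula; nabla' is the connection of the submanifold *)
definition second_ff ::
    "('n, 'b::euclidean_space) atlas \<Rightarrow> ('m, 'a::euclidean_space) atlas \<Rightarrow> ('n \<Rightarrow> 'm) \<Rightarrow>
     ('m, 'a) conn \<Rightarrow> ('n, 'b) conn \<Rightarrow> ('n \<Rightarrow> 'b) \<Rightarrow> ('n \<Rightarrow> 'b) \<Rightarrow> 'n \<Rightarrow> 'a" where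
  "second_ff B A f nabla nabla' X Y p =
     nabla_along B A f nabla p (X p) (\<lambda>q. tangent_map B A f q (Y q))
     - tangent_map B A f p (nabla' p (X p) Y)"


section \<open>Distributions and semi-invariant submanifolds\<close>

(* a smooth subbundle of the tangent bundle, given by local frames; the rank is locally constant *)
definition distribution ::
    "('n::topological_space, 'b::euclidean_space) atlas \<Rightarrow> ('n \<Rightarrow> 'b set) \<Rightarrow> bool" where
  "distribution B D \<longleftrightarrow>
     (\<forall>p. \<exists>U k E. open U \<and> p \<in> U \<and> (\<forall>i<k. smooth_field B U (E i)) \<and>
        (\<forall>q\<in>U. inj_on (\<lambda>i. E i q) {..<k::nat} \<and> independent ((\<lambda>i. E i q) ` {..<k}) \<and>
           D q = span ((\<lambda>i. E i q) ` {..<k})))"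

definition section_of ::
    "('n, 'b::euclidean_space) atlas \<Rightarrow> ('n \<Rightarrow> 'b set) \<Rightarrow> ('n \<Rightarrow> 'b) \<Rightarrow> bool" where
  "section_of B D X \<longleftrightarrow> vector_field B X \<and> (\<forall>p. X p \<in> D p)"

(* integrable in the sense of Warner (Def. 1.56) and Spivak (vol. I, ch. 6): the sections of D are
   closed under the Lie bracket *)
definition integrable_distribution ::
    "('n, 'b::euclidean_space) atlas \<Rightarrow> ('n \<Rightarrow> 'b set) \<Rightarrow> bool" where
  "integrable_distribution B D \<longleftrightarrow>
     (\<forall>X Y. section_of B D X \<longrightarrow> section_of B D Y \<longrightarrow> section_of B D (lie_bracket B X Y))"

definition semi_invariant_xi_perp ::
    "('n::{t2_space, second_countable_topology}, 'b::euclidean_space) atlas \<Rightarrow>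
     ('m::topological_space, 'a::euclidean_space) atlas \<Rightarrow> ('n \<Rightarrow> 'm) \<Rightarrow>
     ('m \<Rightarrow> 'a \<Rightarrow> 'a) \<Rightarrow> ('m \<Rightarrow> 'a) \<Rightarrow> ('m, 'a) metric_tensor \<Rightarrow>
     ('n \<Rightarrow> 'b set) \<Rightarrow> ('n \<Rightarrow> 'b set) \<Rightarrow> bool" where
  "semi_invariant_xi_perp B A f \<phi> \<xi> g D D' \<longleftrightarrow>
     smooth_atlas B \<and> immersion B A f \<and>
     (\<forall>p. normal_vec B A f g p (\<xi> (f p))) \<and>
     distribution B D \<and> distribution B D' \<and>
     (\<forall>p. \<forall>v\<in>D p. \<forall>w\<in>D' p. induced_metric B A f g p v w = 0) \<and>
     (\<forall>p. {v + w | v w. v \<in> D p \<and> w \<in> D' p} = UNIV) \<and>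
     (\<forall>p. \<phi> (f p) ` tangent_map B A f p ` D p = tangent_map B A f p ` D p) \<and>
     (\<forall>p. \<forall>v\<in>D' p. normal_vec B A f g p (\<phi> (f p) (tangent_map B A f p v)))"

(* t in the decomposition of phi X into t X in D and a normal part omega X *)
definition t_part ::
    "('n, 'b::euclidean_space) atlas \<Rightarrow> ('m, 'a::euclidean_space) atlas \<Rightarrow> ('n \<Rightarrow> 'm) \<Rightarrow>
     ('m \<Rightarrow> 'a \<Rightarrow> 'a) \<Rightarrow> ('m, 'a) metric_tensor \<Rightarrow> ('n \<Rightarrow> 'b set) \<Rightarrow> 'n \<Rightarrow> 'b \<Rightarrow> 'b" where
  "t_part B A f \<phi> g D p v =
     (THE w. w \<in> D p \<and>
        normal_vec B A f g p (\<phi> (f p) (tangent_map B A f p v) - tangent_map B A f p w))"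

end

theory Submission
  imports Defs
begin

text \<open>
  For sections \<open>X\<close>, \<open>Y\<close> of \<open>D\<close> we have \<open>\<phi>X = tX\<close> and \<open>\<eta>(X) = 0\<close>, so the structure equation reduces to
  \<open>\<nabla>\<^sub>X(tY) = \<phi>\<nabla>\<^sub>XY + g(\<nabla>\<^bsub>\<phi>X\<^esub>\<xi>, Y)\<xi>\<close>. Applied to \<open>\<xi>\<close> itself it gives \<open>\<nabla>\<^bsub>\<phi>X\<^esub>\<xi> = \<phi>\<nabla>\<^sub>X\<xi>\<close>, whence
  \<open>(L\<^sub>\<xi>g)(X, \<phi>Y) = g(\<nabla>\<^bsub>\<phi>Y\<^esub>\<xi>, X) - g(\<nabla>\<^bsub>\<phi>X\<^esub>\<xi>, Y)\<close>. Antisymmetrizing and using the symmetry of \<open>h\<close>,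
  the normal vector \<open>h(tX, Y) - h(X, tY) - (L\<^sub>\<xi>g)(X, \<phi>Y)\<xi>\<close> differs from \<open>-\<phi>[X, Y]\<close> by a tangent vector.
  Hence it vanishes iff \<open>\<phi>[X, Y]\<close> is tangent, and since \<open>\<phi>\<close> maps \<open>D'\<close> injectively into the normal bundle
  this means \<open>[X, Y] \<in> D\<close>.

  Bump functions enter because the structure equation is only given for global vector fields, and
  \<open>tX\<close> is smooth because it solves a linear equation with smooth injective coefficients.
\<close>

section \<open>Calculus of smooth maps\<close>

text \<open>The fields \<open>X\<close> and \<open>Y\<close> live on the submanifold, and an
  immersion may have self-intersections, so they need not be restrictions of ambient fields and the
  properties of \<open>nabla\<close> cannot simply be quoted for them. \<open>nabla_along\<close> is
  therefore treated as a connection on vector fields along \<open>f\<close>: expansion in the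
  coordinate fields of one ambient chart transfers torsion-freeness, metric compatibility and the
  structure equation to it. Torsion-freeness then rests on the symmetry of the second derivatives of
  \<open>f\<close> in charts. \<open>h\<close> is defined as a difference of two covariant
  derivatives, so both its symmetry and its normality have to be derived. Normality is what makes
  the final step work: a vector that is normal as well as tangent vanishes, and this links the
  equation for \<open>h\<close> to the position of \<open>[X, Y]\<close>. The equivalence is
  pointwise: for fixed sections and a fixed point, the bracket lies in \<open>D\<close> exactly when
  the equation holds there. Smoothness enters through the definition of integrability, and in order
  that \<open>tX\<close> can be differentiated at all.\<close>

lemma ck_on_subset: "ck_on k S f \<Longrightarrow> T \<subseteq> S \<Longrightarrow> ck_on k T f"
proof (induction k arbitrary: f)
  case 0
  then show ?case by (auto intro: continuous_on_subset)
next
  case (Suc k)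
  then obtain f' where "\<forall>x\<in>S. (f has_derivative f' x) (at x)" "\<And>v. ck_on k S (\<lambda>x. f' x v)"
    by auto
  with Suc show ?case by (auto intro!: exI[of _ f'])
qed

lemma ck_on_SucD: "ck_on (Suc k) S f \<Longrightarrow> ck_on k S f"
proof (induction k arbitrary: f)
  case 0
  then show ?case
    by (auto intro!: continuous_at_imp_continuous_on dest: has_derivative_continuous)
next
  case (Suc k)
  then obtain f' where "\<forall>x\<in>S. (f has_derivative f' x) (at x)" "\<And>v. ck_on (Suc k) S (\<lambda>x. f' x v)"
    using ck_on.simps(2)[of "Suc k"] by blast
  with Suc.IH have "\<forall>x\<in>S. (f has_derivative f' x) (at x)" "\<And>v. ck_on k S (\<lambda>x. f' x v)"
    by blast+
  then show ?case by auto
qed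

lemma ck_on_cong:
  assumes "open S" and "\<And>x. x \<in> S \<Longrightarrow> f x = h x" and "ck_on k S f"
  shows "ck_on k S h"
proof (cases k)
  case 0
  then show ?thesis using assms continuous_on_cong by (metis ck_on.simps(1))
next
  case (Suc j)
  then obtain f' where f': "\<forall>x\<in>S. (f has_derivative f' x) (at x)" "\<And>v. ck_on j S (\<lambda>x. f' x v)"
    using assms by auto
  have "\<forall>x\<in>S. (h has_derivative f' x) (at x)"
    using f' assms has_derivative_transform_within_open by blast
  with f' Suc show ?thesis by auto
qed

text \<open>The definition of \<open>ck_on\<close> quantifies existentially over the derivative.
  Derivatives are unique, so on an open set \<open>frechet_derivative\<close> can stand in for every
  witness, and iterated derivatives become concrete functions.\<close>

lemma ck_on_Suc_iff:
  assumes "open S"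
  shows "ck_on (Suc k) S f \<longleftrightarrow>
    (\<forall>x\<in>S. f differentiable at x) \<and> (\<forall>v. ck_on k S (\<lambda>x. frechet_derivative f (at x) v))"
proof
  assume "ck_on (Suc k) S f"
  then obtain f' where f': "\<forall>x\<in>S. (f has_derivative f' x) (at x)" "\<And>v. ck_on k S (\<lambda>x. f' x v)"
    by auto
  have "f' x = frechet_derivative f (at x)" if "x \<in> S" for x
    using f' that frechet_derivative_at by blast
  then have "ck_on k S (\<lambda>x. frechet_derivative f (at x) v)" for v
    by (intro ck_on_cong[OF assms _ f'(2)[of v]]) auto
  with f' show "(\<forall>x\<in>S. f differentiable at x) \<and>
      (\<forall>v. ck_on k S (\<lambda>x. frechet_derivative f (at x) v))"
    by (auto simp: differentiable_def)
next
  assume "(\<forall>x\<in>S. f differentiable at x) \<and> (\<forall>v. ck_on k S (\<lambda>x. frechet_derivative f (at x) v))"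
  then show "ck_on (Suc k) S f"
    by (auto simp: frechet_derivative_works)
qed

text \<open>Witnesses obtained on different neighbourhoods would have to be glued;
  \<open>frechet_derivative\<close> is one function for all of them, so the induction hypothesis
  applies to it directly.\<close>

lemma ck_on_local:
  assumes "open S" and "\<And>x. x \<in> S \<Longrightarrow> \<exists>T. open T \<and> x \<in> T \<and> ck_on k T f"
  shows "ck_on k S f"
  using assms(2)
proof (induction k arbitrary: f)
  case 0
  show ?case
      unfolding ck_on.simps
  proof (intro continuous_at_imp_continuous_on ballI)
    fix x assume "x \<in> S"
    then obtain T where "open T" "x \<in> T" "continuous_on T f" using 0 by force
    then show "isCont f x" using continuous_on_eq_continuous_at by blast
  qed
next
  case (Suc k)
  have *: "\<exists>T. open T \<and> x \<in> T \<and> (\<forall>x\<in>T. f differentiable at x) \<and>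
      (\<forall>v. ck_on k T (\<lambda>x. frechet_derivative f (at x) v))" if "x \<in> S" for x
    using Suc.prems[OF that] ck_on_Suc_iff[of _ k f] by auto
  have "ck_on k S (\<lambda>x. frechet_derivative f (at x) v)" for v
    by (rule Suc.IH) (use * in meson)
  with * show ?case unfolding ck_on_Suc_iff[OF assms(1)] by meson
qed

lemma ck_on_const: "ck_on k S (\<lambda>x. c)"
proof (induction k arbitrary: c)
  case (Suc k)
  then show ?case unfolding ck_on.simps by (intro exI[of _ "\<lambda>x v. 0"]) simp
qed simp

lemma ck_on_ident: "ck_on k S (\<lambda>x. x)"
  by (cases k) (auto intro!: exI[of _ "\<lambda>x v. v"] ck_on_const)

lemma ck_on_linear_compose:
  assumes "linear L" shows "ck_on k S f \<Longrightarrow> ck_on k S (\<lambda>x. L (f x))"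
proof (induction k arbitrary: f)
  case 0
  then show ?case
    using linear_continuous_on_compose[OF _ assms] by simp
next
  case (Suc k)
  then obtain f' where "\<forall>x\<in>S. (f has_derivative f' x) (at x)" "\<And>v. ck_on k S (\<lambda>x. f' x v)"
    by auto
  moreover have "((\<lambda>x. L (f x)) has_derivative (\<lambda>v. L (f' x v))) (at x)"
    if "(f has_derivative f' x) (at x)" for x
    by (rule bounded_linear.has_derivative[OF linear_conv_bounded_linear[THEN iffD1, OF assms] that])
  ultimately show ?case using Suc.IH
    unfolding ck_on.simps by (intro exI[of _ "\<lambda>x v. L (f' x v)"]) blast
qed

lemma ck_on_add: "ck_on k S f \<Longrightarrow> ck_on k S h \<Longrightarrow> ck_on k S (\<lambda>x. f x + h x)"
proof (induction k arbitrary: f h)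
  case 0
  then show ?case by (auto intro: continuous_intros)
next
  case (Suc k)
  obtain f' where "\<forall>x\<in>S. (f has_derivative f' x) (at x)" "\<And>v. ck_on k S (\<lambda>x. f' x v)"
    using Suc by auto
  moreover obtain h' where "\<forall>x\<in>S. (h has_derivative h' x) (at x)" "\<And>v. ck_on k S (\<lambda>x. h' x v)"
    using Suc by auto
  ultimately show ?case using Suc.IH
    by (auto intro!: exI[of _ "\<lambda>x v. f' x v + h' x v"] has_derivative_add)
qed

lemma ck_on_scaleR:
  fixes u :: "'a::euclidean_space \<Rightarrow> real"
  shows "ck_on k S u \<Longrightarrow> ck_on k S f \<Longrightarrow> ck_on k S (\<lambda>x. u x *\<^sub>R f x)"
proof (induction k arbitrary: u f)
  case 0
  then show ?case by (auto intro: continuous_intros)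
next
  case (Suc k)
  obtain f' where f': "\<forall>x\<in>S. (f has_derivative f' x) (at x)" "\<And>v. ck_on k S (\<lambda>x. f' x v)"
    using Suc by auto
  obtain u' where u': "\<forall>x\<in>S. (u has_derivative u' x) (at x)" "\<And>v. ck_on k S (\<lambda>x. u' x v)"
    using Suc by auto
  have "\<forall>x\<in>S. ((\<lambda>x. u x *\<^sub>R f x) has_derivative (\<lambda>v. u x *\<^sub>R f' x v + u' x v *\<^sub>R f x)) (at x)"
    using f' u' by (auto intro: has_derivative_scaleR)
  moreover have "ck_on k S (\<lambda>x. u x *\<^sub>R f' x v + u' x v *\<^sub>R f x)" for v
    by (intro ck_on_add Suc.IH) (use f' u' Suc.prems ck_on_SucD in blast)+
  ultimately show ?case by auto
qed

lemma ck_on_sum: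
  "finite I \<Longrightarrow> (\<And>i. i \<in> I \<Longrightarrow> ck_on k S (f i)) \<Longrightarrow> ck_on k S (\<lambda>x. \<Sum>i\<in>I. f i x)"
  by (induction I rule: finite_induct) (auto intro: ck_on_const ck_on_add)

lemma linear_inner_const: "linear (\<lambda>x. x \<bullet> b)"
  by (rule bounded_linear.linear[OF bounded_linear_inner_left])

text \<open>Turns the value of a linear map at a varying vector into a finite sum of scalar
  functions times values at fixed vectors. \<open>ck_on\<close> speaks of derivatives in fixed
  directions only, so this is the bridge to the chain rule and to Jacobians applied to vector
  fields.\<close>

lemma linear_basis_expansion:
  fixes L :: "'a::euclidean_space \<Rightarrow> 'b::real_vector"
  assumes "linear L" shows "L v = (\<Sum>b\<in>Basis. (v \<bullet> b) *\<^sub>R L b)"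
proof -
  interpret linear L by fact
  have "L v = L (\<Sum>b\<in>Basis. (v \<bullet> b) *\<^sub>R b)"
    by (simp add: euclidean_representation)
  then show ?thesis by (simp add: sum scale)
qed

text \<open>The derivative \<open>f' (h x) (h' x v)\<close> has a direction that varies with
  \<open>x\<close>. After expansion in \<open>Basis\<close> it is a sum of products, to which the
  induction hypothesis for \<open>f'\<close> and the closure rules apply.\<close>

lemma ck_on_compose:
  assumes "ck_on k T f" "ck_on k S h" "h ` S \<subseteq> T"
  shows "ck_on k S (\<lambda>x. f (h x))"
  using assms
proof (induction k arbitrary: f)
  case 0
  then show ?case by (auto intro: continuous_on_compose2)
next
  case (Suc k)
  obtain f' where f': "\<forall>x\<in>T. (f has_derivative f' x) (at x)" "\<And>v. ck_on k T (\<lambda>x. f' x v)"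
    using Suc by auto
  obtain h' where h': "\<forall>x\<in>S. (h has_derivative h' x) (at x)" "\<And>v. ck_on k S (\<lambda>x. h' x v)"
    using Suc by auto
  have "((\<lambda>x. f (h x)) has_derivative (\<lambda>v. \<Sum>b\<in>Basis. (h' x v \<bullet> b) *\<^sub>R f' (h x) b)) (at x)"
    if "x \<in> S" for x
  proof -
    have "(f has_derivative f' (h x)) (at (h x))" using f' Suc that by blast
    then have "linear (f' (h x))" by (rule has_derivative_linear)
    note eq = linear_basis_expansion[OF this, symmetric]
    have "((\<lambda>x. f (h x)) has_derivative (\<lambda>v. f' (h x) (h' x v))) (at x)"
      using has_derivative_compose h' that \<open>(f has_derivative f' (h x)) (at (h x))\<close> by blast
    then show ?thesis by (simp only: eq)
  qed
  moreover have "ck_on k S (\<lambda>x. \<Sum>b\<in>Basis. (h' x v \<bullet> b) *\<^sub>R f' (h x) b)" for v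
    by (intro ck_on_sum ck_on_scaleR ck_on_linear_compose[OF linear_inner_const] finite_Basis
        Suc.IH f'(2) h'(2) ck_on_SucD[OF Suc.prems(2)] Suc.prems(3))
  ultimately show ?case unfolding ck_on.simps
    by (intro exI[of _ "\<lambda>x v. \<Sum>b\<in>Basis. (h' x v \<bullet> b) *\<^sub>R f' (h x) b"]) blast
qed

lemma ck_on_apply:
  assumes "open S" and "\<And>x. x \<in> S \<Longrightarrow> linear (A x)" and "\<And>e. ck_on k S (\<lambda>x. A x e)"
    and "ck_on k S w"
  shows "ck_on k S (\<lambda>x. A x (w x))"
proof (rule ck_on_cong[OF assms(1)])
  show "ck_on k S (\<lambda>x. \<Sum>b\<in>Basis. (w x \<bullet> b) *\<^sub>R A x b)"
    using assms by (intro ck_on_sum ck_on_scaleR ck_on_linear_compose[OF linear_inner_const]) auto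
qed (use assms(2) linear_basis_expansion in metis)

lemma smooth_on_subset: "smooth_on S f \<Longrightarrow> T \<subseteq> S \<Longrightarrow> smooth_on T f"
  unfolding smooth_on_def using ck_on_subset by blast

lemma smooth_on_cong:
  "open S \<Longrightarrow> (\<And>x. x \<in> S \<Longrightarrow> f x = h x) \<Longrightarrow> smooth_on S f \<Longrightarrow> smooth_on S h"
  unfolding smooth_on_def using ck_on_cong by blast

lemma smooth_on_local:
  assumes "open S" and "\<And>x. x \<in> S \<Longrightarrow> \<exists>T. open T \<and> x \<in> T \<and> smooth_on T f"
  shows "smooth_on S f"
  using assms unfolding smooth_on_def by (intro allI ck_on_local) blast+

lemma smooth_on_differentiable: "smooth_on S f \<Longrightarrow> x \<in> S \<Longrightarrow> f differentiable at x"
  unfolding smooth_on_def differentiable_def by (metis ck_on.simps(2))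

lemma smooth_on_isCont: "smooth_on S f \<Longrightarrow> x \<in> S \<Longrightarrow> isCont f x"
  using smooth_on_differentiable differentiable_imp_continuous_within by blast

lemma smooth_on_has_derivative:
  "smooth_on S f \<Longrightarrow> x \<in> S \<Longrightarrow> (f has_derivative frechet_derivative f (at x)) (at x)"
  using smooth_on_differentiable frechet_derivative_works by blast

lemma smooth_on_derivative:
  "open S \<Longrightarrow> smooth_on S f \<Longrightarrow> smooth_on S (\<lambda>x. frechet_derivative f (at x) v)"
  unfolding smooth_on_def using ck_on_Suc_iff by blast

lemma smooth_on_const: "smooth_on S (\<lambda>x. c)"
  unfolding smooth_on_def using ck_on_const by blast

lemma smooth_on_ident: "smooth_on S (\<lambda>x. x)"
  unfolding smooth_on_def using ck_on_ident by blast

lemma smooth_on_linear_compose: "linear L \<Longrightarrow> smooth_on S f \<Longrightarrow> smooth_on S (\<lambda>x. L (f x))"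
  unfolding smooth_on_def using ck_on_linear_compose by blast

lemma smooth_on_add: "smooth_on S f \<Longrightarrow> smooth_on S h \<Longrightarrow> smooth_on S (\<lambda>x. f x + h x)"
  unfolding smooth_on_def using ck_on_add by blast

lemma smooth_on_scaleR:
  fixes u :: "'a::euclidean_space \<Rightarrow> real"
  shows "smooth_on S u \<Longrightarrow> smooth_on S f \<Longrightarrow> smooth_on S (\<lambda>x. u x *\<^sub>R f x)"
  unfolding smooth_on_def using ck_on_scaleR by blast

lemma smooth_on_sum:
  "finite I \<Longrightarrow> (\<And>i. i \<in> I \<Longrightarrow> smooth_on S (f i)) \<Longrightarrow> smooth_on S (\<lambda>x. \<Sum>i\<in>I. f i x)"
  unfolding smooth_on_def using ck_on_sum by blast

lemma smooth_on_compose: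
  "smooth_on T f \<Longrightarrow> smooth_on S h \<Longrightarrow> h ` S \<subseteq> T \<Longrightarrow> smooth_on S (\<lambda>x. f (h x))"
  unfolding smooth_on_def using ck_on_compose by blast

lemma smooth_on_apply:
  assumes "open S" and "\<And>x. x \<in> S \<Longrightarrow> linear (A x)" and "\<And>e. smooth_on S (\<lambda>x. A x e)"
    and "smooth_on S w"
  shows "smooth_on S (\<lambda>x. A x (w x))"
  using assms unfolding smooth_on_def by (blast intro: ck_on_apply)

text \<open>The form in which Jacobians act on vector fields: a derivative taken at a moving point
  and applied to moving components.\<close>

lemma smooth_on_frechet_derivative_apply:
  assumes "open S" "smooth_on S f" "open T" "smooth_on T h" "h ` T \<subseteq> S" "smooth_on T w"
  shows "smooth_on T (\<lambda>x. frechet_derivative f (at (h x)) (w x))"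
proof (rule smooth_on_apply[of T "\<lambda>x. frechet_derivative f (at (h x))" w])
  fix x assume "x \<in> T"
  then have "f differentiable at (h x)"
    using assms by (blast intro: smooth_on_differentiable)
  then show "linear (frechet_derivative f (at (h x)))" by (rule linear_frechet_derivative)
next
  show "smooth_on T (\<lambda>x. frechet_derivative f (at (h x)) e)" for e
    by (rule smooth_on_compose[OF smooth_on_derivative[OF assms(1,2)] assms(4,5)])
qed (use assms in auto)

lemma frechet_derivative_cong:
  assumes "open S" "x \<in> S" "\<And>y. y \<in> S \<Longrightarrow> f y = h y"
  shows "frechet_derivative f (at x) = frechet_derivative h (at x)"
proof -
  have "(f has_derivative d) (at x) \<longleftrightarrow> (h has_derivative d) (at x)" for d
    using assms has_derivative_transform_within_open[of f d x UNIV S h]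
      has_derivative_transform_within_open[of h d x UNIV S f] by auto
  then show ?thesis by (simp add: frechet_derivative_def)
qed

lemma frechet_derivative_apply_eq:
  "(f has_derivative f') (at x) \<Longrightarrow> frechet_derivative f (at x) v = f' v"
  using frechet_derivative_at by metis

lemma bilinear_sum_scaleR:
  assumes "bilinear h"
  shows "h (\<Sum>i\<in>I. a i *\<^sub>R x i) (\<Sum>j\<in>J. c j *\<^sub>R y j) = (\<Sum>i\<in>I. \<Sum>j\<in>J. a i *\<^sub>R c j *\<^sub>R h (x i) (y j))"
  using bilinear_sum[OF assms, of "\<lambda>i. a i *\<^sub>R x i" I "\<lambda>j. c j *\<^sub>R y j" J]
  by (simp add: sum.cartesian_product bilinear_lmul[OF assms(1)] bilinear_rmul[OF assms(1)] mult.commute)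

section \<open>Linear equations with smooth injective coefficients\<close>

lemma norm_linear_diff_le:
  fixes L M :: "'a::euclidean_space \<Rightarrow> 'b::real_normed_vector"
  assumes "linear L" "linear M"
  shows "norm (L v - M v) \<le> (\<Sum>b\<in>Basis. norm (L b - M b)) * norm v"
proof -
  have "L v - M v = (\<Sum>b\<in>Basis. (v \<bullet> b) *\<^sub>R (L b - M b))"
    using linear_basis_expansion[OF linear_compose_sub[OF assms]] .
  also have "norm \<dots> \<le> (\<Sum>b\<in>Basis. norm ((v \<bullet> b) *\<^sub>R (L b - M b)))"
    by (rule norm_sum)
  also have "\<dots> \<le> (\<Sum>b\<in>Basis. norm (L b - M b) * norm v)"
    by (intro sum_mono) (metis Basis_le_norm mult.commute mult_left_mono norm_ge_zero norm_scaleR)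
  finally show ?thesis by (simp add: sum_distrib_right)
qed

text \<open>A system \<open>A x (w x) = b x\<close> is normalized near \<open>x0\<close> by a left
  inverse of \<open>A x0\<close> and by subtracting the value \<open>w x0\<close>. What remains is a
  coefficient that is the identity at \<open>x0\<close> and a solution vanishing there, whose
  regularity at \<open>x0\<close> is to be deduced from that of \<open>r\<close>.\<close>

locale near_identity =
  fixes S :: "'x::euclidean_space set" and x0 :: 'x
    and M :: "'x \<Rightarrow> 'w::euclidean_space \<Rightarrow> 'w" and y r :: "'x \<Rightarrow> 'w"
  assumes S: "open S" "x0 \<in> S" and lin: "\<And>x. x \<in> S \<Longrightarrow> linear (M x)"
    and M0: "\<And>v. M x0 v = v" and cont: "\<And>e. isCont (\<lambda>x. M x e) x0"
    and solution: "\<And>x. x \<in> S \<Longrightarrow> M x (y x) = r x"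
begin

text \<open>Dominates the operator norm of \<open>M x - id\<close>. Being a finite sum over
  \<open>Basis\<close>, it tends to 0 by continuity of \<open>M x e\<close> for each fixed
  \<open>e\<close>.\<close>

definition err where "err x = (\<Sum>b\<in>Basis. norm (M x b - b))"

lemma err_tendsto: "(err \<longlongrightarrow> 0) (at x0)"
proof -
  have "(err \<longlongrightarrow> (\<Sum>b\<in>(Basis::'w set). norm (b - b))) (at x0)"
    unfolding err_def using cont M0 by (intro tendsto_intros) (simp add: isCont_def)
  then show ?thesis by simp
qed

lemma err_bound: "x \<in> S \<Longrightarrow> norm (M x v - v) \<le> err x * norm v"
  using norm_linear_diff_le[OF lin[of x] lin[OF S(2)]] by (simp add: M0 err_def)

lemma eventually_in_S: "eventually (\<lambda>x. x \<in> S) (at x0)"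
  using S by (simp add: eventually_at_in_open')

text \<open>Where \<open>err x < 1/2\<close>, the map \<open>M x\<close> moves a vector by at most
  half its length, so \<open>norm v \<le> norm (M x v) + norm v / 2\<close>. This bound takes the
  place of an inverse of \<open>M x\<close>.\<close>

lemma eventually_lower_bound: "eventually (\<lambda>x. \<forall>v. norm v \<le> 2 * norm (M x v)) (at x0)"
proof -
  have "eventually (\<lambda>x. err x < 1/2) (at x0)"
    using err_tendsto by (rule order_tendstoD) simp
  with eventually_in_S show ?thesis
  proof eventually_elim
    case (elim x)
    show ?case
    proof
      fix v
      have "norm (M x v - v) \<le> 1/2 * norm v"
        using err_bound[OF elim(1), of v] mult_right_mono[of "err x" "1/2" "norm v"] elim(2) by simp
      then show "norm v \<le> 2 * norm (M x v)"
        using norm_triangle_ineq2[of v "M x v"] by (simp add: norm_minus_commute)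
    qed
  qed
qed

lemma isCont_solution:
  assumes "isCont r x0" and y0: "y x0 = 0"
  shows "isCont y x0"
proof -
  have "r x0 = 0" using solution[OF S(2)] M0 y0 by simp
  then have "(r \<longlongrightarrow> 0) (at x0)" using assms by (simp add: isCont_def)
  then have "((\<lambda>x. 2 * norm (r x)) \<longlongrightarrow> 0) (at x0)"
    by (auto intro!: tendsto_eq_intros)
  moreover have "eventually (\<lambda>x. norm (y x) \<le> 2 * norm (r x)) (at x0)"
    using eventually_lower_bound eventually_in_S
    by eventually_elim (use solution in metis)
  ultimately show ?thesis
    unfolding isCont_def y0 by (rule Lim_null_comparison[rotated])
qed

text \<open>Apply \<open>M x\<close> to \<open>y x - r' h\<close> with \<open>h = x - x0\<close>:
  the result is \<open>(r x - r' h) - (M x - id) (r' h)\<close>. The first part is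
  \<open>o(|h|)\<close> by differentiability of \<open>r\<close>, the second because
  \<open>err x\<close> tends to 0; the lower bound carries this back to
  \<open>y x - r' h\<close>.\<close>

lemma has_derivative_solution:
  assumes r: "(r has_derivative r') (at x0)" and y0: "y x0 = 0"
  shows "(y has_derivative r') (at x0)"
proof -
  have bl: "bounded_linear r'" using r by (rule has_derivative_bounded_linear)
  then obtain K where K: "\<And>h. norm (r' h) \<le> norm h * K"
    using bounded_linear.bounded by blast
  have r0: "r x0 = 0" using solution[OF S(2)] M0 y0 by simp
  have 1: "((\<lambda>x. norm (r x - r' (x - x0)) / norm (x - x0)) \<longlongrightarrow> 0) (at x0)"
    using r by (simp add: has_derivative_iff_norm r0)
  have "((\<lambda>x. 2 * (norm (r x - r' (x - x0)) / norm (x - x0) + err x * K)) \<longlongrightarrow> 0) (at x0)"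
    by (rule tendsto_eq_intros 1 err_tendsto refl | simp)+
  moreover have "eventually (\<lambda>x. norm (norm (y x - r' (x - x0)) / norm (x - x0))
      \<le> 2 * (norm (r x - r' (x - x0)) / norm (x - x0) + err x * K)) (at x0)"
    using eventually_lower_bound eventually_in_S eventually_neq_at_within[of x0]
  proof eventually_elim
    case (elim x)
    let ?h = "x - x0"
    interpret Mx: linear "M x" using lin elim by blast
    have "norm (y x - r' ?h) \<le> 2 * norm (M x (y x - r' ?h))" using elim by blast
    also have "M x (y x - r' ?h) = (r x - r' ?h) - (M x (r' ?h) - r' ?h)"
      using elim solution by (simp add: Mx.diff)
    also have "norm \<dots> \<le> norm (r x - r' ?h) + err x * norm (r' ?h)"
      using norm_triangle_ineq4 err_bound[OF elim(2)] by (smt (verit, best))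
    also have "err x * norm (r' ?h) \<le> err x * (norm ?h * K)"
      using K by (intro mult_left_mono) (auto simp: err_def intro: sum_nonneg)
    finally have "norm (y x - r' ?h) \<le> 2 * (norm (r x - r' ?h) + err x * (norm ?h * K))" by simp
    then have "norm (y x - r' ?h) / norm ?h
        \<le> 2 * (norm (r x - r' ?h) + err x * (norm ?h * K)) / norm ?h"
      by (rule divide_right_mono) simp
    also have "\<dots> = 2 * (norm (r x - r' ?h) / norm ?h + err x * K)"
      using elim by (simp add: field_simps)
    finally show ?case by simp
  qed
  ultimately have "((\<lambda>x. norm (y x - r' (x - x0)) / norm (x - x0)) \<longlongrightarrow> 0) (at x0)"
    by (rule Lim_null_comparison[rotated])
  with bl show ?thesis by (simp add: has_derivative_iff_norm y0)
qed

end

text \<open>Only a left inverse is available, since \<open>A x0\<close> is merely injective: in the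
  application it is the Jacobian of an immersion, whose target may have larger dimension.\<close>

lemma near_identity_left_inverse:
  fixes A :: "'x::euclidean_space \<Rightarrow> 'w::euclidean_space \<Rightarrow> 'a::euclidean_space"
  assumes S: "open S" "x0 \<in> S" and lin: "\<And>x. x \<in> S \<Longrightarrow> linear (A x)"
    and cont: "\<And>e. isCont (\<lambda>x. A x e) x0" and L: "linear L" "L \<circ> A x0 = id"
    and eq: "\<And>x. x \<in> S \<Longrightarrow> A x (w x) = b x"
  shows "near_identity S x0 (\<lambda>x v. L (A x v)) (\<lambda>x. w x - w x0) (\<lambda>x. L (b x - A x (w x0)))"
proof (rule near_identity.intro)
  show "linear (\<lambda>v. L (A x v))" if "x \<in> S" for x
    using linear_compose[OF lin[OF that] L(1)] by (simp add: o_def)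
  show "L (A x0 v) = v" for v using L(2) by (metis comp_apply id_apply)
  show "isCont (\<lambda>x. L (A x e)) x0" for e
    using linear_continuous_compose[OF cont L(1)] .
  show "L (A x (w x - w x0)) = L (b x - A x (w x0))" if "x \<in> S" for x
    using eq that lin[OF that] by (simp add: linear_diff)
qed (use S in auto)

text \<open>Differentiating the equation gives a linear system for the derivative of the solution with the
  same left-hand side, so the induction on \<open>k\<close> needs no formula for an inverse of \<open>A\<close>.\<close>

lemma ck_on_linear_solution:
  fixes A :: "'x::euclidean_space \<Rightarrow> 'w::euclidean_space \<Rightarrow> 'a::euclidean_space"
  assumes S: "open S" and lin: "\<And>x. x \<in> S \<Longrightarrow> linear (A x)" and inj: "\<And>x. x \<in> S \<Longrightarrow> inj (A x)"
    and A: "\<And>e. smooth_on S (\<lambda>x. A x e)"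
    and "ck_on k S b" and "\<And>x. x \<in> S \<Longrightarrow> A x (w x) = b x"
  shows "ck_on k S w"
  using assms(5,6)
proof (induction k arbitrary: w b)
  case 0
  have "isCont w x0" if x0: "x0 \<in> S" for x0
  proof -
    obtain L where L: "linear L" "L \<circ> A x0 = id"
      using linear_injective_left_inverse[OF lin inj] x0 by blast
    interpret near_identity S x0 "\<lambda>x v. L (A x v)" "\<lambda>x. w x - w x0" "\<lambda>x. L (b x - A x (w x0))"
      by (rule near_identity_left_inverse[OF S x0 lin smooth_on_isCont[OF A x0] L 0(2)])
    have "isCont b x0" using 0(1) S x0 by (simp add: continuous_on_eq_continuous_at)
    then have "isCont (\<lambda>x. w x - w x0) x0"
      by (intro isCont_solution linear_continuous_compose[OF _ L(1)] continuous_diff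
          smooth_on_isCont[OF A x0]) auto
    from isCont_add[OF this continuous_const[of _ "w x0"]] show ?thesis by simp
  qed
  then show ?case by (simp add: continuous_at_imp_continuous_on)
next
  case (Suc k)
  have b_diff: "b differentiable at x" if "x \<in> S" for x
    using Suc.prems(1) ck_on_Suc_iff[OF S] that by blast
  have w_diff: "w differentiable at x0" if x0: "x0 \<in> S" for x0
  proof -
    obtain L where L: "linear L" "L \<circ> A x0 = id"
      using linear_injective_left_inverse[OF lin inj] x0 by blast
    interpret near_identity S x0 "\<lambda>x v. L (A x v)" "\<lambda>x. w x - w x0" "\<lambda>x. L (b x - A x (w x0))"
      by (rule near_identity_left_inverse[OF S x0 lin smooth_on_isCont[OF A x0] L Suc.prems(2)])
    have "(\<lambda>x. b x - A x (w x0)) differentiable at x0"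
      using b_diff[OF x0] smooth_on_differentiable[OF A x0] by (rule differentiable_diff)
    then obtain d where "((\<lambda>x. b x - A x (w x0)) has_derivative d) (at x0)"
      unfolding differentiable_def by blast
    then have "((\<lambda>x. L (b x - A x (w x0))) has_derivative (\<lambda>h. L (d h))) (at x0)"
      by (rule bounded_linear.has_derivative[OF linear_conv_bounded_linear[THEN iffD1, OF L(1)]])
    then have "((\<lambda>x. w x - w x0) has_derivative (\<lambda>h. L (d h))) (at x0)"
      by (rule has_derivative_solution) simp
    from has_derivative_add[OF this has_derivative_const[of "w x0"]]
    show ?thesis by (auto simp: differentiable_def)
  qed
  \<comment> \<open>\<open>w\<close> itself occurs on the right-hand side of the differentiated
    equation, so its \<open>C^k\<close> regularity is secured before its derivative is
    treated.\<close>
  have w_ck: "ck_on k S w" using Suc.IH ck_on_SucD[OF Suc.prems(1)] Suc.prems(2) by blast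
  have "ck_on k S (\<lambda>x. frechet_derivative w (at x) v)" for v
  proof (rule Suc.IH)
    \<comment> \<open>The product rule for \<open>A x (w x) = b x\<close>, solved for the term in
      which \<open>A x\<close> acts on the derivative of \<open>w\<close>; the derivatives of the
      coefficients enter through their values on \<open>Basis\<close>.\<close>
    let ?b = "\<lambda>x. frechet_derivative b (at x) v
        + (-1) *\<^sub>R (\<Sum>e\<in>Basis. (w x \<bullet> e) *\<^sub>R frechet_derivative (\<lambda>x. A x e) (at x) v)"
    have "ck_on k S (\<lambda>x. frechet_derivative (\<lambda>x. A x e) (at x) v)" for e
      using smooth_on_derivative[OF S A] unfolding smooth_on_def by blast
    moreover have "ck_on k S (\<lambda>x. frechet_derivative b (at x) v)"
      using Suc.prems(1) ck_on_Suc_iff[OF S] by blast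
    ultimately show "ck_on k S ?b"
      using w_ck by (intro ck_on_add ck_on_scaleR ck_on_const ck_on_sum
        ck_on_linear_compose[OF linear_inner_const]) auto
    fix x assume x: "x \<in> S"
    have "((\<lambda>x. (w x \<bullet> e) *\<^sub>R A x e) has_derivative (\<lambda>v. (w x \<bullet> e) *\<^sub>R
        frechet_derivative (\<lambda>x. A x e) (at x) v + (frechet_derivative w (at x) v \<bullet> e) *\<^sub>R A x e)) (at x)"
      for e
      by (intro has_derivative_scaleR smooth_on_has_derivative[OF A x] has_derivative_inner_left
          frechet_derivative_works[THEN iffD1, OF w_diff[OF x]])
    then have "((\<lambda>x. \<Sum>e\<in>Basis. (w x \<bullet> e) *\<^sub>R A x e) has_derivative (\<lambda>v. \<Sum>e\<in>Basis. (w x \<bullet> e) *\<^sub>R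
        frechet_derivative (\<lambda>x. A x e) (at x) v + (frechet_derivative w (at x) v \<bullet> e) *\<^sub>R A x e)) (at x)"
      by (intro has_derivative_sum)
    moreover have "(\<Sum>e\<in>Basis. (w x \<bullet> e) *\<^sub>R A x e) = b x" if "x \<in> S" for x
      using linear_basis_expansion[OF lin[OF that]] Suc.prems(2)[OF that] by metis
    ultimately have "(b has_derivative (\<lambda>v. \<Sum>e\<in>Basis. (w x \<bullet> e) *\<^sub>R
        frechet_derivative (\<lambda>x. A x e) (at x) v + (frechet_derivative w (at x) v \<bullet> e) *\<^sub>R A x e)) (at x)"
      using has_derivative_transform_within_open[OF _ S x] by blast
    from fun_cong[OF frechet_derivative_at[OF this], of v]
    have "frechet_derivative b (at x) v = (\<Sum>e\<in>Basis. (w x \<bullet> e) *\<^sub>R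
        frechet_derivative (\<lambda>x. A x e) (at x) v + (frechet_derivative w (at x) v \<bullet> e) *\<^sub>R A x e)"
      by (rule sym)
    then show "A x (frechet_derivative w (at x) v) = ?b x"
      by (simp add: sum.distrib linear_basis_expansion[OF lin[OF x], of "frechet_derivative w (at x) v"])
  qed
  with w_diff show ?case using ck_on_Suc_iff[OF S] by blast
qed

lemma smooth_on_linear_solution:
  fixes A :: "'x::euclidean_space \<Rightarrow> 'w::euclidean_space \<Rightarrow> 'a::euclidean_space"
  assumes "open S" and "\<And>x. x \<in> S \<Longrightarrow> linear (A x)" and "\<And>x. x \<in> S \<Longrightarrow> inj (A x)"
    and "\<And>e. smooth_on S (\<lambda>x. A x e)"
    and "smooth_on S b" and "\<And>x. x \<in> S \<Longrightarrow> A x (w x) = b x"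
  shows "smooth_on S w"
  unfolding smooth_on_def
proof
  show "ck_on k S w" for k
    by (rule ck_on_linear_solution[OF assms(1-4) _ assms(6)])
      (use assms(5) smooth_on_def in auto)
qed

section \<open>Symmetry of second derivatives\<close>

lemma second_difference_tendsto:
  fixes f :: "'a::real_normed_vector \<Rightarrow> real"
  assumes S: "open S" "x \<in> S" and f': "\<And>y. y \<in> S \<Longrightarrow> (f has_derivative f' y) (at y)"
    and L: "((\<lambda>y. f' y v) has_derivative L) (at x)"
  shows "((\<lambda>t. (f (x + t *\<^sub>R v + t *\<^sub>R w) - f (x + t *\<^sub>R v) - f (x + t *\<^sub>R w) + f x) / t\<^sup>2)
    \<longlongrightarrow> L w) (at_right 0)"
proof (rule tendstoI)
  fix e :: real assume e: "e > 0"
  \<comment> \<open>\<open>t * C\<close> bounds the norm of \<open>s v + s' w\<close> for all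
    \<open>s\<close>, \<open>s'\<close> in \<open>[0, t]\<close>; the summand 1 keeps
    \<open>C\<close> positive when both vectors vanish. Each of the two derivative errors below is
    at most \<open>e' * (t * C)\<close>, so after division by \<open>t\<close> their total is
    \<open>2 * e' * C = e / 2\<close>.\<close>
  define C where "C = norm v + norm w + 1"
  have C: "C > 0" unfolding C_def by (smt (verit) norm_ge_zero)
  define e' where "e' = e / (4 * C)"
  have e': "e' > 0" using e C by (simp add: e'_def)
  obtain d where d: "d > 0"
    "\<And>y. norm (y - x) < d \<Longrightarrow> norm (f' y v - f' x v - L (y - x)) \<le> e' * norm (y - x)"
    using L e' unfolding has_derivative_at_alt by meson
  obtain r where r: "r > 0" "ball x r \<subseteq> S" using S open_contains_ball by blast
  interpret L: bounded_linear L using L by (rule has_derivative_bounded_linear)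
  have "eventually (\<lambda>t. 0 < t \<and> t < min d r / C) (at_right (0::real))"
    using d(1) r(1) C by (intro eventually_conj) (auto simp: eventually_at_right_less
        intro!: eventually_at_rightI[of 0 "min d r / C"])
  then show "eventually (\<lambda>t. dist ((f (x + t *\<^sub>R v + t *\<^sub>R w) - f (x + t *\<^sub>R v) - f (x + t *\<^sub>R w)
      + f x) / t\<^sup>2) (L w) < e) (at_right 0)"
  proof eventually_elim
    case (elim t)
    then have t: "t > 0" "t * C < d" "t * C < r" using C by (auto simp: field_simps)
    have bound: "norm (s *\<^sub>R v + s' *\<^sub>R w) \<le> t * C" if "0 \<le> s" "s \<le> t" "0 \<le> s'" "s' \<le> t" for s s'
    proof -
      have "norm (s *\<^sub>R v + s' *\<^sub>R w) \<le> s * norm v + s' * norm w"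
        using norm_triangle_ineq[of "s *\<^sub>R v" "s' *\<^sub>R w"] that by simp
      also have "\<dots> \<le> t * norm v + t * norm w"
        using that by (intro add_mono mult_right_mono) auto
      also have "\<dots> \<le> t * C" using t by (simp add: C_def algebra_simps)
      finally show ?thesis .
    qed
    have in_S: "x + s *\<^sub>R v + s' *\<^sub>R w \<in> S" if "0 \<le> s" "s \<le> t" "0 \<le> s'" "s' \<le> t" for s s'
      using bound[OF that] t r by (auto simp: dist_norm add.assoc subset_iff norm_minus_commute
          intro!: r(2)[THEN subsetD])
    have der: "((\<lambda>s. f (x + s *\<^sub>R v + s' *\<^sub>R w)) has_real_derivative f' (x + s *\<^sub>R v + s' *\<^sub>R w) v) (at s)"
      if "0 \<le> s" "s \<le> t" "0 \<le> s'" "s' \<le> t" for s s'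
    proof -
      note fd = f'[OF in_S[OF that]]
      have "((\<lambda>s. x + s *\<^sub>R v + s' *\<^sub>R w) has_derivative (\<lambda>h. h *\<^sub>R v)) (at s)"
        by (auto intro!: derivative_eq_intros)
      from has_derivative_compose[OF this fd]
      have "((\<lambda>s. f (x + s *\<^sub>R v + s' *\<^sub>R w)) has_derivative
          (\<lambda>h. f' (x + s *\<^sub>R v + s' *\<^sub>R w) (h *\<^sub>R v))) (at s)" .
      then show ?thesis
        unfolding has_field_derivative_def
        by (rule has_derivative_eq_rhs)
          (simp add: fun_eq_iff linear_cmul[OF has_derivative_linear[OF fd]] mult.commute)
    qed
    \<comment> \<open>Mean value theorem for \<open>f (x + s v + t w) - f (x + s v)\<close> as a
      function of \<open>s\<close> between 0 and \<open>t\<close>. The summands with factor 0 stay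
      unsimplified so that \<open>der\<close> matches with \<open>s' = 0\<close>.\<close>
    obtain s where s: "0 < s" "s < t"
      "(f (x + t *\<^sub>R v + t *\<^sub>R w) - f (x + t *\<^sub>R v + 0 *\<^sub>R w))
         - (f (x + 0 *\<^sub>R v + t *\<^sub>R w) - f (x + 0 *\<^sub>R v + 0 *\<^sub>R w))
       = (t - 0) * (f' (x + s *\<^sub>R v + t *\<^sub>R w) v - f' (x + s *\<^sub>R v + 0 *\<^sub>R w) v)"
      using MVT2[of 0 t "\<lambda>s. f (x + s *\<^sub>R v + t *\<^sub>R w) - f (x + s *\<^sub>R v + 0 *\<^sub>R w)"
          "\<lambda>s. f' (x + s *\<^sub>R v + t *\<^sub>R w) v - f' (x + s *\<^sub>R v + 0 *\<^sub>R w) v"]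
        DERIV_diff[OF der der] t(1) by (auto simp del: scaleR_zero_left)
    define p q where "p = s *\<^sub>R v + t *\<^sub>R w" and "q = s *\<^sub>R v + 0 *\<^sub>R w"
    have pq: "norm p \<le> t * C" "norm q \<le> t * C"
      unfolding p_def q_def using bound s t by (simp_all del: scaleR_zero_left)
    have "norm (f' (x + p) v - f' x v - L p) \<le> e' * norm p"
      "norm (f' (x + q) v - f' x v - L q) \<le> e' * norm q"
      using d(2)[of "x + p"] d(2)[of "x + q"] pq t by auto
    moreover have "e' * norm p \<le> e' * (t * C)" "e' * norm q \<le> e' * (t * C)"
      using pq e' by auto
    moreover have "L p - L q = t * L w" by (simp add: p_def q_def L.add L.scaleR)
    ultimately have "\<bar>f' (x + p) v - f' (x + q) v - t * L w\<bar> \<le> 2 * e' * (t * C)"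
      by (simp add: real_norm_def)
    then have "\<bar>(f' (x + p) v - f' (x + q) v - t * L w) / t\<bar> \<le> 2 * e' * C"
      using t(1) by (simp add: abs_divide field_simps)
    moreover have Q: "f (x + t *\<^sub>R v + t *\<^sub>R w) - f (x + t *\<^sub>R v) - f (x + t *\<^sub>R w) + f x
       = t * (f' (x + p) v - f' (x + q) v)"
      using s(3) by (simp add: p_def q_def add.assoc)
    have "(f (x + t *\<^sub>R v + t *\<^sub>R w) - f (x + t *\<^sub>R v) - f (x + t *\<^sub>R w) + f x) / t\<^sup>2 - L w
       = (f' (x + p) v - f' (x + q) v - t * L w) / t"
      unfolding Q using t(1) by (simp add: field_simps power2_eq_square)
    moreover have "2 * e' * C = e / 2" using C by (simp add: e'_def)
    ultimately have "\<bar>(f (x + t *\<^sub>R v + t *\<^sub>R w) - f (x + t *\<^sub>R v) - f (x + t *\<^sub>R w) + f x) / t\<^sup>2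
        - L w\<bar> \<le> e / 2" by (simp only:)
    then show ?case using e by (simp add: dist_real_def)
  qed
qed

text \<open>The second difference quotient is symmetric in \<open>v\<close> and \<open>w\<close>,
  and both iterated derivatives are its limit. The mean value theorem behind this limit concerns
  real functions, hence the passage to components.\<close>

lemma second_derivative_symmetric:
  fixes f :: "'a::euclidean_space \<Rightarrow> 'b::euclidean_space"
  assumes S: "open S" "x \<in> S" and f: "smooth_on S f"
  shows "frechet_derivative (\<lambda>y. frechet_derivative f (at y) v) (at x) w
    = frechet_derivative (\<lambda>y. frechet_derivative f (at y) w) (at x) v"
proof (rule euclidean_eqI)
  fix b :: 'b assume "b \<in> Basis"
  have f': "((\<lambda>y. f y \<bullet> b) has_derivative (\<lambda>v. frechet_derivative f (at y) v \<bullet> b)) (at y)"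
    if "y \<in> S" for y
    using has_derivative_inner_left[OF smooth_on_has_derivative[OF f that]] .
  have L: "((\<lambda>y. frechet_derivative f (at y) v \<bullet> b) has_derivative
      (\<lambda>w. frechet_derivative (\<lambda>y. frechet_derivative f (at y) v) (at x) w \<bullet> b)) (at x)" for v
    using has_derivative_inner_left[OF smooth_on_has_derivative[OF smooth_on_derivative[OF S(1) f] S(2)]] .
  have swap: "(f (x + t *\<^sub>R v + t *\<^sub>R w) \<bullet> b - f (x + t *\<^sub>R v) \<bullet> b - f (x + t *\<^sub>R w) \<bullet> b + f x \<bullet> b)
    = (f (x + t *\<^sub>R w + t *\<^sub>R v) \<bullet> b - f (x + t *\<^sub>R w) \<bullet> b - f (x + t *\<^sub>R v) \<bullet> b + f x \<bullet> b)" for t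
    by (simp add: add.commute add.left_commute)
  show "frechet_derivative (\<lambda>y. frechet_derivative f (at y) v) (at x) w \<bullet> b
    = frechet_derivative (\<lambda>y. frechet_derivative f (at y) w) (at x) v \<bullet> b"
    by (rule tendsto_unique[OF _ second_difference_tendsto[OF S f' L, of v w]
          second_difference_tendsto[OF S f' L, of w v, folded swap]]) auto
qed

section \<open>Smooth bump functions\<close>

definition flat :: "nat \<Rightarrow> real \<Rightarrow> real" where
  "flat n t = (if t > 0 then (1 / t) ^ n * exp (- (1 / t)) else 0)"

text \<open>With \<open>u = 1 / t\<close> the right-hand limit is that of
  \<open>u ^ n / exp u\<close> as \<open>u\<close> grows; on the left of 0 the function
  vanishes.\<close>

lemma flat_tendsto_0: "(flat n \<longlongrightarrow> 0) (at 0)"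
proof -
  have "((\<lambda>t. inverse t ^ n / exp (inverse t)) \<longlongrightarrow> 0) (at_right (0::real))"
    by (rule filterlim_compose[OF tendsto_power_div_exp_0 filterlim_inverse_at_top_right])
  moreover have "eventually (\<lambda>t. inverse t ^ n / exp (inverse t) = flat n t) (at_right 0)"
    by (rule eventually_at_rightI[of 0 1]) (auto simp: flat_def exp_minus divide_simps)
  ultimately have "(flat n \<longlongrightarrow> 0) (at_right 0)" by (rule Lim_transform_eventually)
  moreover have "eventually (\<lambda>t. 0 = flat n t) (at_left 0)"
    by (rule eventually_at_leftI[of "-1" 0]) (auto simp: flat_def)
  then have "(flat n \<longlongrightarrow> 0) (at_left 0)" by (rule Lim_transform_eventually[OF tendsto_const])
  ultimately show ?thesis by (simp add: filterlim_at_split)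
qed

text \<open>The powers of \<open>1 / t\<close> are part of \<open>flat\<close> so that the family is
  closed, up to linear combinations, under differentiation; \<open>flat 0\<close> is the classical
  \<open>exp (- (1 / t))\<close> extended by 0.\<close>

lemma flat_has_derivative:
  "(flat n has_real_derivative flat (n + 2) t - n * flat (n + 1) t) (at t)"
proof -
  consider "t > 0" | "t < 0" | "t = 0" by linarith
  then show ?thesis
  proof cases
    case 1
    \<comment> \<open>The power rule yields the exponent \<open>n - Suc 0\<close>, truncated for
      \<open>n = 0\<close>, where the factor \<open>n\<close> removes the term.\<close>
    have pow: "n = 0 \<or> t ^ n = t * t ^ (n - Suc 0)" by (cases n) auto
    have "((\<lambda>t. (1 / t) ^ n * exp (- (1 / t))) has_real_derivative
        flat (n + 2) t - n * flat (n + 1) t) (at t)"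
      using 1 pow by (auto intro!: derivative_eq_intros
          simp: flat_def power2_eq_square field_simps)
    then show ?thesis
      by (rule has_field_derivative_transform_within_open[of _ _ _ "{0<..}"])
        (use 1 in \<open>auto simp: flat_def\<close>)
  next
    case 2
    have "((\<lambda>t. 0) has_real_derivative flat (n + 2) t - n * flat (n + 1) t) (at t)"
      using 2 by (simp add: flat_def)
    then show ?thesis
      by (rule has_field_derivative_transform_within_open[of _ _ _ "{..<0}"])
        (use 2 in \<open>auto simp: flat_def\<close>)
  next
    case 3
    \<comment> \<open>Division by \<open>h\<close> raises the exponent of \<open>1 / h\<close> by
      one; at \<open>h = 0\<close> both sides are 0 because division by zero gives 0.\<close>
    have "(\<lambda>h. (flat n (0 + h) - flat n 0) / h) = flat (n + 1)"
      by (auto simp: flat_def fun_eq_iff)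
    then show ?thesis using flat_tendsto_0[of "n + 1"] 3
      by (simp add: DERIV_def flat_def)
  qed
qed

lemma smooth_on_flat: "smooth_on UNIV (flat n)"
proof -
  have "ck_on k UNIV (flat n)" for k
  proof (induction k arbitrary: n)
    case 0
    show ?case
      using flat_has_derivative DERIV_isCont continuous_at_imp_continuous_on by (metis ck_on.simps(1))
  next
    case (Suc k)
    let ?d = "\<lambda>t v. v *\<^sub>R (flat (n + 2) t + (- real n) *\<^sub>R flat (n + 1) t)"
    have "(flat n has_derivative ?d t) (at t)" for t
      using flat_has_derivative[of n t] unfolding has_field_derivative_def
      by (rule has_derivative_eq_rhs) (auto simp: fun_eq_iff mult.commute)
    moreover have "ck_on k UNIV (\<lambda>t. ?d t v)" for v
      by (intro ck_on_scaleR ck_on_add ck_on_const Suc.IH)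
    ultimately show ?case unfolding ck_on.simps by (intro exI[of _ ?d]) blast
  qed
  then show ?thesis by (simp add: smooth_on_def)
qed

lemma smooth_on_inner_self:
  fixes h :: "'a::euclidean_space \<Rightarrow> 'b::euclidean_space"
  assumes "smooth_on S h"
  shows "smooth_on S (\<lambda>x. h x \<bullet> h x)"
proof -
  have "smooth_on S (\<lambda>x. \<Sum>b\<in>Basis. (h x \<bullet> b) *\<^sub>R (h x \<bullet> b))"
    by (intro smooth_on_sum smooth_on_scaleR smooth_on_linear_compose[OF linear_inner_const] assms
        finite_Basis)
  also have "(\<lambda>x. \<Sum>b\<in>Basis. (h x \<bullet> b) *\<^sub>R (h x \<bullet> b)) = (\<lambda>x. h x \<bullet> h x)"
    using euclidean_inner[of "h _" "h _"] by auto
  finally show ?thesis .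
qed

text \<open>The normalization fixes the value 1 at the centre only, without a plateau. That is
  enough later because the terms containing the derivative of the cutoff cancel.\<close>

lemma smooth_bump:
  fixes x0 :: "'a::euclidean_space"
  assumes "r > 0"
  obtains \<beta> :: "'a \<Rightarrow> real"
  where "smooth_on UNIV \<beta>" "\<beta> x0 = 1" "\<And>x. x \<notin> ball x0 r \<Longrightarrow> \<beta> x = 0"
proof
  \<comment> \<open>The squared distance is smooth, unlike the distance itself, so \<open>?q\<close>
    is smooth; it is positive exactly on the open ball. The factor in \<open>?\<beta>\<close>
    normalizes the value at \<open>x0\<close>.\<close>
  let ?q = "\<lambda>x. r\<^sup>2 + (-1) *\<^sub>R ((x + (- x0)) \<bullet> (x + (- x0)))"
  let ?\<beta> = "\<lambda>x. (1 / flat 0 (r\<^sup>2)) *\<^sub>R flat 0 (?q x)"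
  show "smooth_on UNIV ?\<beta>"
    by (intro smooth_on_scaleR smooth_on_const smooth_on_compose[OF smooth_on_flat] smooth_on_add
        smooth_on_inner_self smooth_on_ident) simp
  show "?\<beta> x0 = 1" using assms by (simp add: flat_def)
  show "?\<beta> x = 0" if "x \<notin> ball x0 r" for x
  proof -
    have "r \<le> norm (x - x0)" using that by (simp add: dist_norm norm_minus_commute)
    then have "r\<^sup>2 \<le> (x - x0) \<bullet> (x - x0)"
      using assms power_mono[of r "norm (x - x0)" 2] by (simp add: power2_norm_eq_inner)
    then show ?thesis by (simp add: flat_def)
  qed
qed

section \<open>Manifolds and connections\<close>

locale smooth_manifold =
  fixes A :: "('m::{t2_space, second_countable_topology}, 'a::euclidean_space) atlas"
  assumes smooth_atlas: "smooth_atlas A"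
begin

lemma chart: "c \<in> A \<Longrightarrow> is_chart c"
  using smooth_atlas by (simp add: smooth_atlas_def)

lemma chart_homeomorphism:
  "c \<in> A \<Longrightarrow> homeomorphism (cdom c) (cmap c ` cdom c) (cmap c) (cinv c)"
  using chart by (simp add: is_chart_def)

lemma open_cdom: "c \<in> A \<Longrightarrow> open (cdom c)"
  using chart by (simp add: is_chart_def)

lemma cinv_cmap [simp]: "c \<in> A \<Longrightarrow> p \<in> cdom c \<Longrightarrow> cinv c (cmap c p) = p"
  using chart_homeomorphism homeomorphism_apply1 by blast

lemma open_cmap_image:
  assumes "c \<in> A" "open U" "U \<subseteq> cdom c" shows "open (cmap c ` U)"
proof -
  have "openin (top_of_set (cdom c)) U"
    using assms open_cdom by (simp add: openin_open_eq)
  then have "openin (top_of_set (cmap c ` cdom c)) (cmap c ` U)"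
    using homeomorphism_imp_open_map[OF chart_homeomorphism[OF assms(1)]] by blast
  then show ?thesis
    using chart[OF assms(1)] by (simp add: is_chart_def openin_open_eq)
qed

lemma open_cmap_Int: "c \<in> A \<Longrightarrow> open U \<Longrightarrow> open (cmap c ` (U \<inter> cdom c))"
  using open_cmap_image open_cdom by blast

lemma chart_at_in [simp]: "chart_at A p \<in> A" and in_chart_at [simp]: "p \<in> cdom (chart_at A p)"
proof -
  obtain c where "c \<in> A \<and> p \<in> cdom c"
    using smooth_atlas unfolding smooth_atlas_def by blast
  then have "chart_at A p \<in> A \<and> p \<in> cdom (chart_at A p)"
    unfolding chart_at_def by (rule someI)
  then show "chart_at A p \<in> A" "p \<in> cdom (chart_at A p)" by auto
qed

lemma smooth_transition:
  "c \<in> A \<Longrightarrow> d \<in> A \<Longrightarrow> smooth_on (cmap c ` (cdom c \<inter> cdom d)) (cmap d \<circ> cinv c)"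
  using smooth_atlas by (simp add: smooth_atlas_def)

lemma transition_has_derivative:
  assumes "c \<in> A" "d \<in> A" "p \<in> cdom c" "p \<in> cdom d"
  shows "((cmap d \<circ> cinv c) has_derivative coord_change c d p) (at (cmap c p))"
  unfolding coord_change_def using smooth_on_has_derivative[OF smooth_transition] assms by blast

lemma linear_coord_change:
  "c \<in> A \<Longrightarrow> d \<in> A \<Longrightarrow> p \<in> cdom c \<Longrightarrow> p \<in> cdom d \<Longrightarrow> linear (coord_change c d p)"
  using transition_has_derivative has_derivative_linear by blast

lemma coord_change_self [simp]:
  assumes "c \<in> A" "p \<in> cdom c" shows "coord_change c c p v = v"
proof -
  have "((\<lambda>x. x) has_derivative (\<lambda>v. v)) (at (cmap c p))" by simp
  then have "((cmap c \<circ> cinv c) has_derivative (\<lambda>v. v)) (at (cmap c p))"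
    by (rule has_derivative_transform_within_open[where s="cmap c ` cdom c"])
      (use assms open_cmap_image open_cdom in auto)
  then show ?thesis
    unfolding coord_change_def by (metis frechet_derivative_at)
qed

text \<open>Chain rule through \<open>d\<close>. The composite is compared with the direct
  transition on the image of \<open>cdom d \<inter> cdom c\<close>, an open neighbourhood of
  \<open>cmap c p\<close>.\<close>

lemma coord_change_trans:
  assumes "c \<in> A" "d \<in> A" "e \<in> A" "p \<in> cdom c" "p \<in> cdom d" "p \<in> cdom e"
  shows "coord_change d e p (coord_change c d p v) = coord_change c e p v"
proof -
  have "((cmap e \<circ> cinv d) has_derivative coord_change d e p) (at ((cmap d \<circ> cinv c) (cmap c p)))"
    using transition_has_derivative[of d e p] assms by simp
  from has_derivative_compose[OF transition_has_derivative[of c d p] this]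
  have "((\<lambda>x. (cmap e \<circ> cinv d) ((cmap d \<circ> cinv c) x)) has_derivative
      (\<lambda>v. coord_change d e p (coord_change c d p v))) (at (cmap c p))"
    using assms by simp
  then have "((cmap e \<circ> cinv c) has_derivative (\<lambda>v. coord_change d e p (coord_change c d p v)))
      (at (cmap c p))"
    by (rule has_derivative_transform_within_open[where s="cmap c ` (cdom d \<inter> cdom c)"])
      (use assms open_cmap_Int open_cdom in auto)
  from frechet_derivative_at[OF this] show ?thesis
    unfolding coord_change_def[of c e] by metis
qed

lemma linear_tcoord: "c \<in> A \<Longrightarrow> p \<in> cdom c \<Longrightarrow> linear (tcoord A c p)"
  using linear_coord_change[of "chart_at A p" c p] by (simp add: tcoord_def[abs_def])

lemma tcoord_chart_at [simp]: "tcoord A (chart_at A p) p v = v"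
  by (simp add: tcoord_def)

lemma coord_change_tcoord:
  "c \<in> A \<Longrightarrow> d \<in> A \<Longrightarrow> p \<in> cdom c \<Longrightarrow> p \<in> cdom d \<Longrightarrow>
    coord_change c d p (tcoord A c p v) = tcoord A d p v"
  by (simp add: tcoord_def coord_change_trans)

lemma tcoord_coord_field [simp]:
  "c \<in> A \<Longrightarrow> p \<in> cdom c \<Longrightarrow> tcoord A c p (coord_field A c w p) = w"
  by (simp add: tcoord_def coord_field_def coord_change_trans)

lemma coord_field_tcoord:
  "c \<in> A \<Longrightarrow> p \<in> cdom c \<Longrightarrow> coord_field A c (tcoord A c p v) p = v"
  by (simp add: tcoord_def coord_field_def coord_change_trans)

lemma coord_field_chart_at [simp]: "coord_field A (chart_at A p) w p = w"
  by (simp add: coord_field_def)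

lemma linear_coord_field:
  "c \<in> A \<Longrightarrow> p \<in> cdom c \<Longrightarrow> linear (\<lambda>w. coord_field A c w p)"
  unfolding coord_field_def[abs_def]
  using linear_coord_change[of c "chart_at A p" p] by simp

lemma coord_field_expansion:
  assumes "c \<in> A" "p \<in> cdom c"
  shows "v = (\<Sum>b\<in>Basis. (tcoord A c p v \<bullet> b) *\<^sub>R coord_field A c b p)"
  using linear_basis_expansion[OF linear_coord_field[OF assms], of "tcoord A c p v"]
  by (simp add: coord_field_tcoord assms)

lemma field_rep_cmap [simp]:
  "c \<in> A \<Longrightarrow> p \<in> cdom c \<Longrightarrow> field_rep A c X (cmap c p) = tcoord A c p (X p)"
  by (simp add: field_rep_def)

section \<open>Smooth vector fields and functions on open sets\<close>

lemma smooth_field_subset: "smooth_field A U X \<Longrightarrow> V \<subseteq> U \<Longrightarrow> smooth_field A V X"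
  unfolding smooth_field_def
  by (meson smooth_on_subset Int_mono image_mono subset_refl)

lemma smooth_field_cong:
  assumes "open U" "\<And>p. p \<in> U \<Longrightarrow> X p = Y p" "smooth_field A U X"
  shows "smooth_field A U Y"
  unfolding smooth_field_def
proof
  fix c assume c: "c \<in> A"
  show "smooth_on (cmap c ` (U \<inter> cdom c)) (field_rep A c Y)"
    by (rule smooth_on_cong[where f="field_rep A c X"])
      (use assms c open_cmap_Int in \<open>auto simp: smooth_field_def\<close>)
qed

lemma smooth_fun_cong:
  assumes "open U" "\<And>p. p \<in> U \<Longrightarrow> u p = u' p" "smooth_fun A U u"
  shows "smooth_fun A U u'"
  unfolding smooth_fun_def
proof
  fix c assume c: "c \<in> A"
  show "smooth_on (cmap c ` (U \<inter> cdom c)) (u' \<circ> cinv c)"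
    by (rule smooth_on_cong[where f="u \<circ> cinv c"])
      (use assms c open_cmap_Int in \<open>auto simp: smooth_fun_def\<close>)
qed

lemma smooth_on_transition:
  assumes "c \<in> A" "d \<in> A" "open V"
  shows "smooth_on (cmap d ` (V \<inter> cdom c \<inter> cdom d)) (cmap c \<circ> cinv d)"
  by (rule smooth_on_subset[OF smooth_transition[OF assms(2,1)]]) auto

text \<open>\<open>smooth_field\<close> demands smoothness in every chart. Passing from
  \<open>c\<close> to \<open>d\<close> multiplies the components by the Jacobian of a smooth
  transition map, so one chart near each point decides.\<close>

lemma smooth_field_local:
  assumes U: "open U" and loc: "\<And>p. p \<in> U \<Longrightarrow> \<exists>c\<in>A. \<exists>V. open V \<and> p \<in> V \<inter> cdom c \<and>
      smooth_on (cmap c ` (V \<inter> cdom c)) (field_rep A c X)"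
  shows "smooth_field A U X"
  unfolding smooth_field_def
proof
  fix d assume d: "d \<in> A"
  show "smooth_on (cmap d ` (U \<inter> cdom d)) (field_rep A d X)"
  proof (rule smooth_on_local)
    show "open (cmap d ` (U \<inter> cdom d))" using open_cmap_Int U d by blast
    fix x assume "x \<in> cmap d ` (U \<inter> cdom d)"
    then obtain p where p: "p \<in> U" "p \<in> cdom d" "x = cmap d p" by auto
    then obtain c V where c: "c \<in> A" "open V" "p \<in> V" "p \<in> cdom c"
      "smooth_on (cmap c ` (V \<inter> cdom c)) (field_rep A c X)" using loc by blast
    let ?T = "cmap d ` (V \<inter> cdom c \<inter> cdom d)" and ?\<tau> = "cmap c \<circ> cinv d"
    have T: "open ?T" using c d open_cmap_Int open_cdom by blast
    have \<tau>: "smooth_on ?T ?\<tau>" using smooth_on_transition c d by blast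
    have "smooth_on ?T (\<lambda>y. frechet_derivative (cmap d \<circ> cinv c) (at (?\<tau> y)) (field_rep A c X (?\<tau> y)))"
    proof (rule smooth_on_frechet_derivative_apply[OF _ smooth_transition[OF c(1) d] T \<tau>])
      show "open (cmap c ` (cdom c \<inter> cdom d))"
        using open_cmap_Int[OF c(1) open_cdom[OF d]] by (simp add: Int_commute)
      show "smooth_on ?T (\<lambda>y. field_rep A c X (?\<tau> y))"
        by (rule smooth_on_compose[OF c(5) \<tau>]) (use c d in auto)
    qed (use c d in auto)
    then have "smooth_on ?T (field_rep A d X)"
      by (rule smooth_on_cong[OF T, rotated])
        (use c d in \<open>auto simp: coord_change_def[symmetric] coord_change_tcoord\<close>)
    then show "\<exists>T. open T \<and> x \<in> T \<and> smooth_on T (field_rep A d X)"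
      using T p c by blast
  qed
qed

lemma smooth_fun_local:
  assumes U: "open U" and loc: "\<And>p. p \<in> U \<Longrightarrow> \<exists>c\<in>A. \<exists>V. open V \<and> p \<in> V \<inter> cdom c \<and>
      smooth_on (cmap c ` (V \<inter> cdom c)) (u \<circ> cinv c)"
  shows "smooth_fun A U u"
  unfolding smooth_fun_def
proof
  fix d assume d: "d \<in> A"
  show "smooth_on (cmap d ` (U \<inter> cdom d)) (u \<circ> cinv d)"
  proof (rule smooth_on_local)
    show "open (cmap d ` (U \<inter> cdom d))" using open_cmap_Int U d by blast
    fix x assume "x \<in> cmap d ` (U \<inter> cdom d)"
    then obtain p where p: "p \<in> U" "p \<in> cdom d" "x = cmap d p" by auto
    then obtain c V where c: "c \<in> A" "open V" "p \<in> V" "p \<in> cdom c"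
      "smooth_on (cmap c ` (V \<inter> cdom c)) (u \<circ> cinv c)" using loc by blast
    let ?T = "cmap d ` (V \<inter> cdom c \<inter> cdom d)" and ?\<tau> = "cmap c \<circ> cinv d"
    have T: "open ?T" using c d open_cmap_Int open_cdom by blast
    have \<tau>: "smooth_on ?T ?\<tau>" using smooth_on_transition c d by blast
    have "smooth_on ?T (\<lambda>y. (u \<circ> cinv c) (?\<tau> y))"
      by (rule smooth_on_compose[OF c(5) \<tau>]) (use c d in auto)
    then have "smooth_on ?T (u \<circ> cinv d)"
      by (rule smooth_on_cong[OF T, rotated]) (use c d in auto)
    then show "\<exists>T. open T \<and> x \<in> T \<and> smooth_on T (u \<circ> cinv d)"
      using T p c by blast
  qed
qed

lemma smooth_field_coord_field: "c \<in> A \<Longrightarrow> smooth_field A (cdom c) (coord_field A c w)"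
proof (rule smooth_field_local)
  assume c: "c \<in> A"
  fix p assume "p \<in> cdom c"
  moreover have "smooth_on (cmap c ` (cdom c \<inter> cdom c)) (field_rep A c (coord_field A c w))"
    by (rule smooth_on_cong[OF _ _ smooth_on_const[of _ w]])
      (use c open_cmap_image open_cdom in auto)
  ultimately show "\<exists>d\<in>A. \<exists>V. open V \<and> p \<in> V \<inter> cdom d \<and>
      smooth_on (cmap d ` (V \<inter> cdom d)) (field_rep A d (coord_field A c w))"
    using c open_cdom by blast
qed (rule open_cdom)

lemma smooth_field_add:
  assumes "open U" "smooth_field A U X" "smooth_field A U Y"
  shows "smooth_field A U (\<lambda>p. X p + Y p)"
  unfolding smooth_field_def
proof
  fix c assume c: "c \<in> A"
  show "smooth_on (cmap c ` (U \<inter> cdom c)) (field_rep A c (\<lambda>p. X p + Y p))"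
    by (rule smooth_on_cong[OF _ _ smooth_on_add[of _ "field_rep A c X" "field_rep A c Y"]])
      (use assms c open_cmap_Int in \<open>auto simp: smooth_field_def linear_add linear_tcoord\<close>)
qed

lemma smooth_field_scaleR:
  assumes "open U" "smooth_fun A U u" "smooth_field A U X"
  shows "smooth_field A U (\<lambda>p. u p *\<^sub>R X p)"
  unfolding smooth_field_def
proof
  fix c assume c: "c \<in> A"
  show "smooth_on (cmap c ` (U \<inter> cdom c)) (field_rep A c (\<lambda>p. u p *\<^sub>R X p))"
    by (rule smooth_on_cong[OF _ _ smooth_on_scaleR[of _ "u \<circ> cinv c" "field_rep A c X"]])
      (use assms c open_cmap_Int in
        \<open>auto simp: smooth_field_def smooth_fun_def linear_cmul linear_tcoord\<close>)
qed

lemma smooth_fun_const: "smooth_fun A U (\<lambda>p. r)"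
  by (auto simp: smooth_fun_def o_def smooth_on_const)

lemma smooth_field_zero: "open U \<Longrightarrow> smooth_field A U (\<lambda>p. 0)"
proof (rule smooth_field_local)
  assume "open U"
  fix p assume "p \<in> U"
  have "smooth_on (cmap (chart_at A p) ` (UNIV \<inter> cdom (chart_at A p)))
      (field_rep A (chart_at A p) (\<lambda>p. 0))"
    by (rule smooth_on_cong[OF _ _ smooth_on_const[of _ 0]])
      (use open_cmap_Int[of "chart_at A p" UNIV] in \<open>auto simp: linear_0 linear_tcoord\<close>)
  then show "\<exists>c\<in>A. \<exists>V. open V \<and> p \<in> V \<inter> cdom c \<and>
      smooth_on (cmap c ` (V \<inter> cdom c)) (field_rep A c (\<lambda>p. 0))"
    using chart_at_in in_chart_at open_UNIV by blast
qed

lemma smooth_field_sum: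
  assumes "open U"
  shows "finite I \<Longrightarrow> (\<And>i. i \<in> I \<Longrightarrow> smooth_field A U (X i)) \<Longrightarrow>
    smooth_field A U (\<lambda>p. \<Sum>i\<in>I. X i p)"
  by (induction I rule: finite_induct) (auto intro: smooth_field_add smooth_field_zero assms)

lemma smooth_fun_component:
  assumes "open U" "smooth_field A U X" "c \<in> A"
  shows "smooth_fun A (U \<inter> cdom c) (\<lambda>p. tcoord A c p (X p) \<bullet> b)"
proof (rule smooth_fun_local)
  show U: "open (U \<inter> cdom c)" using assms open_cdom by blast
  fix p assume "p \<in> U \<inter> cdom c"
  moreover have "smooth_on (cmap c ` (U \<inter> cdom c)) ((\<lambda>p. tcoord A c p (X p) \<bullet> b) \<circ> cinv c)"
    by (rule smooth_on_cong[OF _ _ smooth_on_linear_compose[OF linear_inner_const, of _ "field_rep A c X" b]])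
      (use assms open_cmap_Int in \<open>auto simp: smooth_field_def\<close>)
  ultimately show "\<exists>d\<in>A. \<exists>V. open V \<and> p \<in> V \<inter> cdom d \<and>
      smooth_on (cmap d ` (V \<inter> cdom d)) ((\<lambda>p. tcoord A c p (X p) \<bullet> b) \<circ> cinv d)"
    using assms by blast
qed

lemma smooth_field_has_derivative:
  assumes "open U" "smooth_field A U X" "p \<in> U" "c \<in> A" "p \<in> cdom c"
  shows "(field_rep A c X has_derivative frechet_derivative (field_rep A c X) (at (cmap c p)))
    (at (cmap c p))"
  by (rule smooth_on_has_derivative[where S="cmap c ` (U \<inter> cdom c)"])
    (use assms in \<open>auto simp: smooth_field_def\<close>)

lemma dir_deriv_cong:
  assumes "open U" "p \<in> U" "\<And>q. q \<in> U \<Longrightarrow> u q = u' q"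
  shows "dir_deriv A p v u = dir_deriv A p v u'"
proof -
  let ?c = "chart_at A p"
  have "frechet_derivative (u \<circ> cinv ?c) (at (cmap ?c p)) = frechet_derivative (u' \<circ> cinv ?c) (at (cmap ?c p))"
    by (rule frechet_derivative_cong[where S="cmap ?c ` (U \<inter> cdom ?c)"])
      (use assms open_cmap_Int[of ?c U] in auto)
  then show ?thesis by (simp add: dir_deriv_def)
qed

lemma dir_deriv_const: "dir_deriv A p v (\<lambda>q. r) = 0"
  by (simp add: dir_deriv_def o_def)

lemma smooth_field_open_cover:
  assumes "open U" "\<And>p. p \<in> U \<Longrightarrow> \<exists>V. open V \<and> p \<in> V \<and> smooth_field A V X"
  shows "smooth_field A U X"
proof (rule smooth_field_local[OF assms(1)])
  fix p assume "p \<in> U"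
  then obtain V where "open V" "p \<in> V" "smooth_field A V X" using assms(2) by blast
  then show "\<exists>c\<in>A. \<exists>V. open V \<and> p \<in> V \<inter> cdom c \<and>
      smooth_on (cmap c ` (V \<inter> cdom c)) (field_rep A c X)"
    unfolding smooth_field_def using chart_at_in[of p] in_chart_at[of p] by blast
qed

text \<open>A bump function on the chart image is extended by 0. Its ball is chosen with closure
  inside the image, so the preimage of the closed ball is compact, hence closed in a Hausdorff
  space, and the extended field vanishes on the open complement. One cutoff serves all directions
  \<open>w\<close>.\<close>

lemma global_cutoff:
  assumes c: "c \<in> A" "p \<in> cdom c"
  obtains \<beta> :: "'m \<Rightarrow> real" where "smooth_fun A (cdom c) \<beta>" "\<beta> p = 1"
    "\<And>w. vector_field A (\<lambda>q. \<beta> q *\<^sub>R coord_field A c w q)"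
proof -
  have oc: "open (cdom c)" and oi: "open (cmap c ` cdom c)"
    using c open_cdom open_cmap_image by auto
  obtain r where r: "r > 0" "cball (cmap c p) r \<subseteq> cmap c ` cdom c"
    using oi c open_contains_cball by (metis image_eqI)
  obtain \<beta>0 :: "'a \<Rightarrow> real" where b: "smooth_on UNIV \<beta>0" "\<beta>0 (cmap c p) = 1"
    "\<And>x. x \<notin> ball (cmap c p) r \<Longrightarrow> \<beta>0 x = 0" using smooth_bump[OF r(1)] by metis
  define \<beta> where "\<beta> q = (if q \<in> cdom c then \<beta>0 (cmap c q) else 0)" for q
  have s1: "smooth_fun A (cdom c) \<beta>"
  proof (rule smooth_fun_local[OF oc])
    fix q assume "q \<in> cdom c"
    moreover have "smooth_on (cmap c ` (cdom c \<inter> cdom c)) (\<beta> \<circ> cinv c)"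
      by (rule smooth_on_cong[OF _ _ smooth_on_subset[OF b(1)]])
        (use oi c in \<open>auto simp: \<beta>_def\<close>)
    ultimately show "\<exists>d\<in>A. \<exists>V. open V \<and> q \<in> V \<inter> cdom d \<and>
        smooth_on (cmap d ` (V \<inter> cdom d)) (\<beta> \<circ> cinv d)" using c oc by blast
  qed
  have s2: "vector_field A (\<lambda>q. \<beta> q *\<^sub>R coord_field A c w q)" for w
  proof (rule smooth_field_open_cover)
    fix q
    show "\<exists>V. open V \<and> q \<in> V \<and> smooth_field A V (\<lambda>q. \<beta> q *\<^sub>R coord_field A c w q)"
    proof (cases "q \<in> cdom c")
      case True
      then show ?thesis
        using smooth_field_scaleR[OF oc s1 smooth_field_coord_field[OF c(1)]] oc by blast
    next
      case False
      let ?K = "cinv c ` cball (cmap c p) r"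
      have "continuous_on (cmap c ` cdom c) (cinv c)"
        using chart_homeomorphism[OF c(1)] homeomorphism_def by blast
      then have "compact ?K"
        using compact_continuous_image[OF continuous_on_subset] r(2) compact_cball by blast
      then have o: "open (- ?K)" using compact_imp_closed by blast
      have "?K \<subseteq> cdom c" using r(2) c(1) by auto
      then have q: "q \<in> - ?K" using False by blast
      have "\<beta> q' = 0" if "q' \<in> - ?K" for q'
        using that b(3)[of "cmap c q'"] c(1) unfolding \<beta>_def
        by (metis ComplD ball_subset_cball cinv_cmap image_eqI subsetD)
      then have "smooth_field A (- ?K) (\<lambda>q. \<beta> q *\<^sub>R coord_field A c w q)"
        by (intro smooth_field_cong[OF o _ smooth_field_zero[OF o]]) auto
      with o q show ?thesis by blast
    qed
  qed simp
  show ?thesis by (rule that[OF s1 _ s2]) (use b c in \<open>simp add: \<beta>_def\<close>)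
qed

end

section \<open>Affine connections: locality and coordinates\<close>

locale manifold_connection = smooth_manifold A
  for A :: "('m::{t2_space, second_countable_topology}, 'a::euclidean_space) atlas" +
  fixes nabla :: "('m, 'a) conn"
  assumes connection: "affine_connection A nabla"
begin

lemma linear_nabla:
  "open U \<Longrightarrow> smooth_field A U Y \<Longrightarrow> p \<in> U \<Longrightarrow> linear (\<lambda>v. nabla p v Y)"
  using connection[unfolded affine_connection_def, THEN spec[of _ U], THEN mp] by simp

lemma nabla_add:
  "open U \<Longrightarrow> smooth_field A U Y \<Longrightarrow> smooth_field A U Z \<Longrightarrow> p \<in> U \<Longrightarrow>
    nabla p v (\<lambda>q. Y q + Z q) = nabla p v Y + nabla p v Z"
  using connection[unfolded affine_connection_def, THEN spec[of _ U], THEN mp] by simp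

lemma nabla_scaleR:
  "open U \<Longrightarrow> smooth_fun A U u \<Longrightarrow> smooth_field A U Y \<Longrightarrow> p \<in> U \<Longrightarrow>
    nabla p v (\<lambda>q. u q *\<^sub>R Y q) = dir_deriv A p v u *\<^sub>R Y p + u p *\<^sub>R nabla p v Y"
  using connection[unfolded affine_connection_def, THEN spec[of _ U], THEN mp] by simp

lemma smooth_field_nabla:
  "open U \<Longrightarrow> smooth_field A U X \<Longrightarrow> smooth_field A U Y \<Longrightarrow>
    smooth_field A U (\<lambda>p. nabla p (X p) Y)"
  using connection[unfolded affine_connection_def, THEN spec[of _ U], THEN mp] by simp

lemma nabla_zero: "nabla p v (\<lambda>q. 0) = 0"
  using nabla_add[OF open_UNIV smooth_field_zero smooth_field_zero, of p v] by simp

lemma nabla_sum: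
  assumes "open U" "p \<in> U"
  shows "finite I \<Longrightarrow> (\<And>i. i \<in> I \<Longrightarrow> smooth_field A U (Y i)) \<Longrightarrow>
    nabla p v (\<lambda>q. \<Sum>i\<in>I. Y i q) = (\<Sum>i\<in>I. nabla p v (Y i))"
proof (induction I rule: finite_induct)
  case (insert i I)
  then have "nabla p v (\<lambda>q. Y i q + (\<Sum>i\<in>I. Y i q)) = nabla p v (Y i) + nabla p v (\<lambda>q. \<Sum>i\<in>I. Y i q)"
    using assms by (intro nabla_add[of U] smooth_field_sum) auto
  with insert show ?case by simp
qed (simp add: nabla_zero)

text \<open>\<open>smooth_fun A U\<close> ignores values off \<open>U\<close>, so the indicator of
  \<open>U\<close> counts as smooth; multiplied by it, both fields become the same function on the
  whole type.\<close>

lemma nabla_cong: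
  assumes U: "open U" "p \<in> U" and Y: "smooth_field A U Y" and eq: "\<And>q. q \<in> U \<Longrightarrow> Y q = Z q"
  shows "nabla p v Y = nabla p v Z"
proof -
  let ?u = "\<lambda>q. if q \<in> U then 1 else 0 :: real"
  have Z: "smooth_field A U Z" using smooth_field_cong[OF U(1) eq Y] .
  have u: "smooth_fun A U ?u"
    by (rule smooth_fun_cong[OF U(1) _ smooth_fun_const[of _ 1]]) auto
  have "dir_deriv A p v ?u = dir_deriv A p v (\<lambda>q. 1)"
    by (rule dir_deriv_cong[OF U]) auto
  then have du: "dir_deriv A p v ?u = 0" by (simp add: dir_deriv_const)
  have "(\<lambda>q. ?u q *\<^sub>R Y q) = (\<lambda>q. ?u q *\<^sub>R Z q)" using eq by auto
  then have "nabla p v (\<lambda>q. ?u q *\<^sub>R Y q) = nabla p v (\<lambda>q. ?u q *\<^sub>R Z q)" by simp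
  then show ?thesis
    unfolding nabla_scaleR[OF U(1) u Y U(2)] nabla_scaleR[OF U(1) u Z U(2)] du using U by simp
qed

text \<open>Product rule for the expansion of \<open>Y\<close> in coordinate fields near
  \<open>p\<close>. In the preferred chart the field belonging to \<open>b\<close> has the value
  \<open>b\<close> at \<open>p\<close>, so the derivatives of the components reassemble to the
  ordinary derivative. The formula has the same shape as the definition of
  \<open>nabla_along\<close>.\<close>

lemma nabla_coordinates:
  assumes U: "open U" "p \<in> U" and Y: "smooth_field A U Y"
  defines "c \<equiv> chart_at A p"
  shows "nabla p v Y = frechet_derivative (field_rep A c Y) (at (cmap c p)) v
    + (\<Sum>b\<in>Basis. (Y p \<bullet> b) *\<^sub>R nabla p v (coord_field A c b))"
proof -
  have c: "c \<in> A" "p \<in> cdom c" by (simp_all add: c_def)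
  let ?W = "U \<inter> cdom c" and ?u = "\<lambda>b q. tcoord A c q (Y q) \<bullet> b"
  have W: "open ?W" "p \<in> ?W" using open_Int[OF U(1) open_cdom[OF c(1)]] U c by auto
  have E: "smooth_field A ?W (coord_field A c b)" for b
    using smooth_field_subset[OF smooth_field_coord_field[OF c(1)]] by blast
  have u: "smooth_fun A ?W (?u b)" for b by (rule smooth_fun_component[OF U(1) Y c(1)])
  note D = smooth_field_has_derivative[OF U(1) Y U(2) c]
  let ?D = "frechet_derivative (field_rep A c Y) (at (cmap c p))"
  have du: "dir_deriv A p v (?u b) = ?D v \<bullet> b" for b
  proof -
    have "((\<lambda>x. field_rep A c Y x \<bullet> b) has_derivative (\<lambda>v. ?D v \<bullet> b)) (at (cmap c p))"
      using D by (rule has_derivative_inner_left)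
    moreover have "(\<lambda>x. field_rep A c Y x \<bullet> b) = ?u b \<circ> cinv c"
      by (simp add: fun_eq_iff field_rep_def)
    ultimately have "((?u b \<circ> cinv c) has_derivative (\<lambda>v. ?D v \<bullet> b)) (at (cmap c p))" by simp
    then show ?thesis
      unfolding dir_deriv_def c_def[symmetric] by (rule frechet_derivative_apply_eq)
  qed
  have "nabla p v Y = nabla p v (\<lambda>q. \<Sum>b\<in>Basis. ?u b q *\<^sub>R coord_field A c b q)"
    by (rule nabla_cong[OF W smooth_field_subset[OF Y]])
      (use coord_field_expansion[OF c(1)] in auto)
  also have "\<dots> = (\<Sum>b\<in>Basis. nabla p v (\<lambda>q. ?u b q *\<^sub>R coord_field A c b q))"
    by (rule nabla_sum[OF W]) (auto intro: smooth_field_scaleR W u E)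
  also have "\<dots> = (\<Sum>b\<in>Basis. (?D v \<bullet> b) *\<^sub>R b + (Y p \<bullet> b) *\<^sub>R nabla p v (coord_field A c b))"
    unfolding nabla_scaleR[OF W(1) u E W(2)] du by (simp add: c_def)
  also have "\<dots> = ?D v + (\<Sum>b\<in>Basis. (Y p \<bullet> b) *\<^sub>R nabla p v (coord_field A c b))"
    by (simp add: sum.distrib euclidean_representation)
  finally show ?thesis .
qed

end

section \<open>Levi-Civita connections\<close>

locale levi_civita_connection = manifold_connection A nabla
  for A :: "('m::{t2_space, second_countable_topology}, 'a::euclidean_space) atlas"
    and nabla :: "('m, 'a) conn" +
  fixes g :: "('m, 'a) metric_tensor"
  assumes levi_civita: "levi_civita A g nabla"
begin

lemma torsion_free:
  "open U \<Longrightarrow> smooth_field A U X \<Longrightarrow> smooth_field A U Y \<Longrightarrow> p \<in> U \<Longrightarrow>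
    nabla p (X p) Y - nabla p (Y p) X = lie_bracket A X Y p"
  using levi_civita unfolding levi_civita_def by meson

lemma metric_compatible:
  "open U \<Longrightarrow> smooth_field A U X \<Longrightarrow> smooth_field A U Y \<Longrightarrow> p \<in> U \<Longrightarrow>
    dir_deriv A p v (\<lambda>q. g q (X q) (Y q)) = g p (nabla p v X) (Y p) + g p (X p) (nabla p v Y)"
  using levi_civita unfolding levi_civita_def by meson

text \<open>The symmetry of the Christoffel symbols: coordinate fields have constant components in
  \<open>d\<close>, so their bracket vanishes.\<close>

lemma nabla_coord_field_commute:
  assumes d: "d = chart_at A q"
  shows "nabla q v (coord_field A d w) = nabla q w (coord_field A d v)"
proof -
  have dA: "d \<in> A" "q \<in> cdom d" by (simp_all add: d)
  have "frechet_derivative (field_rep A d (coord_field A d u)) (at (cmap d q)) = (\<lambda>v. 0)" for u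
  proof -
    have "frechet_derivative (field_rep A d (coord_field A d u)) (at (cmap d q))
        = frechet_derivative (\<lambda>x. u) (at (cmap d q))"
      by (rule frechet_derivative_cong[where S="cmap d ` cdom d"])
        (use dA open_cmap_image open_cdom in auto)
    then show ?thesis by simp
  qed
  then have "lie_bracket A (coord_field A d v) (coord_field A d w) q = 0"
    by (simp add: lie_bracket_def Let_def flip: d)
  then show ?thesis
    using torsion_free[OF open_cdom[OF dA(1)] smooth_field_coord_field[OF dA(1)]
        smooth_field_coord_field[OF dA(1)] dA(2), of v w] by (simp add: d)
qed

end

section \<open>Consequences of the structure equation on the ambient manifold\<close>

locale gqs_manifold = smooth_manifold A
  for A :: "('m::{t2_space, second_countable_topology}, 'a::euclidean_space) atlas" +
  fixes \<phi> :: "'m \<Rightarrow> 'a \<Rightarrow> 'a" and \<xi> :: "'m \<Rightarrow> 'a" and \<eta> :: "'m \<Rightarrow> 'a \<Rightarrow> real"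
    and g :: "('m, 'a) metric_tensor" and nabla :: "('m, 'a) conn"
  assumes gqs: "generalized_quasi_sasakian A \<phi> \<xi> \<eta> g nabla"
begin

sublocale levi_civita_connection A nabla g
  using gqs by unfold_locales (auto simp: generalized_quasi_sasakian_def levi_civita_def)

lemma almost_contact: "almost_contact_metric A \<phi> \<xi> \<eta> g"
  using gqs by (simp add: generalized_quasi_sasakian_def)

lemma linear_phi: "linear (\<phi> p)"
  and smooth_phi: "open U \<Longrightarrow> smooth_field A U X \<Longrightarrow> smooth_field A U (\<lambda>p. \<phi> p (X p))"
  and smooth_xi: "vector_field A \<xi>"
  and phi_phi: "\<phi> p (\<phi> p v) = - v + \<eta> p v *\<^sub>R \<xi> p"
  and phi_xi: "\<phi> p (\<xi> p) = 0"
  and eta_eq: "\<eta> p v = g p v (\<xi> p)"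
  and phi_skew: "g p (\<phi> p v) w = - g p v (\<phi> p w)"
  and metric: "riemannian_metric A g"
  using almost_contact unfolding almost_contact_metric_def by (simp_all add: eq_neg_iff_add_eq_0)

lemma eta_xi: "\<eta> p (\<xi> p) = 1"
  using almost_contact unfolding almost_contact_metric_def by blast

lemma bilinear_metric: "bilinear (g p)"
  and metric_sym: "g p v w = g p w v"
  and metric_pos: "v \<noteq> 0 \<Longrightarrow> g p v v > 0"
  and smooth_metric: "open U \<Longrightarrow> smooth_field A U X \<Longrightarrow> smooth_field A U Y \<Longrightarrow>
      smooth_fun A U (\<lambda>p. g p (X p) (Y p))"
  using metric unfolding riemannian_metric_def by auto

lemmas metric_simps =
  bilinear_ladd[OF bilinear_metric] bilinear_radd[OF bilinear_metric]
  bilinear_lsub[OF bilinear_metric] bilinear_rsub[OF bilinear_metric]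
  bilinear_lmul[OF bilinear_metric] bilinear_rmul[OF bilinear_metric]
  bilinear_lneg[OF bilinear_metric] bilinear_rneg[OF bilinear_metric]
  bilinear_lzero[OF bilinear_metric] bilinear_rzero[OF bilinear_metric]

lemma gqs_global:
  "vector_field A X \<Longrightarrow> vector_field A Y \<Longrightarrow>
    nabla p (X p) (\<lambda>q. \<phi> q (Y q)) - \<phi> p (nabla p (X p) Y)
      = g p (nabla p (\<phi> p (X p)) \<xi>) (Y p) *\<^sub>R \<xi> p - \<eta> p (Y p) *\<^sub>R nabla p (\<phi> p (X p)) \<xi>"
  using gqs unfolding generalized_quasi_sasakian_def by meson

text \<open>Coordinate fields live on a chart domain, so \<open>v\<close> and \<open>w\<close> are
  both extended by cut-off fields. The product rule contributes
  \<open>dir_deriv A p v \<beta>\<close> times \<open>\<phi> p w\<close> to each of the two terms on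
  the left, and the contributions cancel.\<close>

lemma gqs_coord_field:
  assumes "c = chart_at A p"
  shows "nabla p v (\<lambda>q. \<phi> q (coord_field A c w q)) - \<phi> p (nabla p v (coord_field A c w))
    = g p (nabla p (\<phi> p v) \<xi>) w *\<^sub>R \<xi> p - \<eta> p w *\<^sub>R nabla p (\<phi> p v) \<xi>"
proof -
  have c: "c \<in> A" "p \<in> cdom c" by (simp_all add: assms)
  note oc = open_cdom[OF c(1)]
  obtain \<beta> where b: "smooth_fun A (cdom c) \<beta>" "\<beta> p = 1"
    "\<And>w. vector_field A (\<lambda>q. \<beta> q *\<^sub>R coord_field A c w q)"
    using global_cutoff[OF c] by blast
  have E: "coord_field A c w p = w" for w by (simp add: assms)
  note sE = smooth_field_coord_field[OF c(1), of w]
  have "nabla p v (\<lambda>q. \<phi> q (\<beta> q *\<^sub>R coord_field A c w q))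
      - \<phi> p (nabla p v (\<lambda>q. \<beta> q *\<^sub>R coord_field A c w q))
    = g p (nabla p (\<phi> p v) \<xi>) w *\<^sub>R \<xi> p - \<eta> p w *\<^sub>R nabla p (\<phi> p v) \<xi>"
    using gqs_global[OF b(3)[of v] b(3)[of w], of p] by (simp add: b(2) E)
  moreover have "nabla p v (\<lambda>q. \<phi> q (\<beta> q *\<^sub>R coord_field A c w q))
    = dir_deriv A p v \<beta> *\<^sub>R \<phi> p w + nabla p v (\<lambda>q. \<phi> q (coord_field A c w q))"
    using nabla_scaleR[OF oc b(1) smooth_phi[OF oc sE] c(2)]
    by (simp add: linear_cmul[OF linear_phi] b(2) E)
  moreover have "nabla p v (\<lambda>q. \<beta> q *\<^sub>R coord_field A c w q)
    = dir_deriv A p v \<beta> *\<^sub>R w + nabla p v (coord_field A c w)"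
    using nabla_scaleR[OF oc b(1) sE c(2)] by (simp add: b(2) E)
  ultimately show ?thesis
    by (simp add: linear_add[OF linear_phi] linear_cmul[OF linear_phi])
qed

text \<open>\<open>\<xi>\<close> has constant length 1. This removes the multiple of
  \<open>\<xi>\<close> on the right when the structure equation is applied to
  \<open>\<xi>\<close>.\<close>

lemma metric_nabla_xi_xi: "g p (nabla p v \<xi>) (\<xi> p) = 0"
proof -
  have "(\<lambda>q. g q (\<xi> q) (\<xi> q)) = (\<lambda>q. 1)" using eta_eq eta_xi by (simp add: fun_eq_iff flip: eta_eq)
  then have "dir_deriv A p v (\<lambda>q. g q (\<xi> q) (\<xi> q)) = 0" by (simp add: dir_deriv_const)
  then show ?thesis
    using metric_compatible[OF open_UNIV smooth_xi smooth_xi, of p v]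
      metric_sym[of p "\<xi> p" "nabla p v \<xi>"] by simp
qed

lemma nabla_phi_xi: "nabla p (\<phi> p v) \<xi> = \<phi> p (nabla p v \<xi>)"
proof -
  let ?c = "chart_at A p"
  obtain \<beta> where b: "\<beta> p = 1" "vector_field A (\<lambda>q. \<beta> q *\<^sub>R coord_field A ?c v q)"
    using global_cutoff[of ?c p] by auto
  show ?thesis
    using gqs_global[OF b(2) smooth_xi, of p] b(1)
    by (simp add: phi_xi nabla_zero metric_nabla_xi_xi eta_xi)
qed

text \<open>With the brackets written through the torsion-free connection, the derivatives of the
  two extensions along \<open>\<xi>\<close> cancel against those produced by metric compatibility;
  only derivatives of \<open>\<xi>\<close> survive.\<close>

lemma lie_deriv_metric_xi:
  "lie_deriv_metric A \<xi> g p v w = g p (nabla p v \<xi>) w + g p v (nabla p w \<xi>)"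
proof -
  let ?c = "chart_at A p"
  note oc = open_cdom[OF chart_at_in[of p]] and sE = smooth_field_coord_field[OF chart_at_in[of p]]
    and s\<xi> = smooth_field_subset[OF smooth_xi subset_UNIV]
  have "lie_bracket A \<xi> (coord_field A ?c u) p = nabla p (\<xi> p) (coord_field A ?c u) - nabla p u \<xi>" for u
    using torsion_free[OF oc s\<xi> sE, of p u] by simp
  then show ?thesis
    unfolding lie_deriv_metric_def lie_deriv_fields_def
    by (simp add: metric_compatible[OF oc sE sE] metric_simps)
qed

end

section \<open>Vector fields along a map\<close>

locale smooth_manifold_map = N: smooth_manifold B + M: smooth_manifold A
  for B :: "('n::{t2_space, second_countable_topology}, 'b::euclidean_space) atlas"
    and A :: "('m::{t2_space, second_countable_topology}, 'a::euclidean_space) atlas" +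
  fixes f :: "'n \<Rightarrow> 'm"
  assumes smooth: "smooth_map B A f"
begin

abbreviation F where "F \<equiv> tangent_map B A f"

abbreviation rep :: "('n, 'b) chart \<Rightarrow> ('m, 'a) chart \<Rightarrow> 'b \<Rightarrow> 'a" where
  "rep c d \<equiv> cmap d \<circ> f \<circ> cinv c"

abbreviation along :: "('n, 'b) chart \<Rightarrow> ('m, 'a) chart \<Rightarrow> ('n \<Rightarrow> 'a) \<Rightarrow> 'b \<Rightarrow> 'a" where
  "along c d V \<equiv> \<lambda>x. tcoord A d (f (cinv c x)) (V (cinv c x))"

lemma open_preimage: "open W \<Longrightarrow> open (f -` W)"
  using smooth open_vimage unfolding smooth_map_def by blast

lemma open_dom:
  "c \<in> B \<Longrightarrow> d \<in> A \<Longrightarrow> open U \<Longrightarrow> open (cmap c ` (U \<inter> f -` cdom d \<inter> cdom c))"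
  by (intro N.open_cmap_Int open_Int open_preimage M.open_cdom)

lemma smooth_rep:
  assumes "c \<in> B" "d \<in> A" shows "smooth_on (cmap c ` (U \<inter> f -` cdom d \<inter> cdom c)) (rep c d)"
proof -
  have "smooth_on (cmap c ` (cdom c \<inter> f -` cdom d)) (rep c d)"
    using smooth assms by (simp add: smooth_map_def)
  then show ?thesis by (rule smooth_on_subset) auto
qed

lemma rep_has_derivative:
  assumes "c \<in> B" "d \<in> A" "p \<in> cdom c" "f p \<in> cdom d"
  shows "(rep c d has_derivative frechet_derivative (rep c d) (at (cmap c p))) (at (cmap c p))"
  using smooth_on_has_derivative[OF smooth_rep[of c d UNIV]] assms by auto

lemma tangent_map_has_derivative:
  "(rep (chart_at B p) (chart_at A (f p)) has_derivative F p) (at (cmap (chart_at B p) p))"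
  unfolding tangent_map_def by (rule rep_has_derivative) simp_all

lemma linear_F: "linear (F p)"
  using tangent_map_has_derivative has_derivative_linear by blast

text \<open>\<open>F\<close> is defined in the preferred charts. In other charts the chain rule
  through the preferred ones surrounds it with coordinate changes on both sides.\<close>

lemma rep_derivative:
  assumes c: "c \<in> B" "p \<in> cdom c" and d: "d \<in> A" "f p \<in> cdom d"
  shows "frechet_derivative (rep c d) (at (cmap c p)) (tcoord B c p v) = tcoord A d (f p) (F p v)"
proof -
  let ?c = "chart_at B p" and ?d = "chart_at A (f p)"
  have 1: "((cmap ?c \<circ> cinv c) has_derivative coord_change c ?c p) (at (cmap c p))"
    by (rule N.transition_has_derivative) (use c in auto)
  have 2: "(rep ?c ?d has_derivative F p) (at ((cmap ?c \<circ> cinv c) (cmap c p)))"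
    using tangent_map_has_derivative c by simp
  have 3: "((cmap d \<circ> cinv ?d) has_derivative coord_change ?d d (f p))
      (at (rep ?c ?d ((cmap ?c \<circ> cinv c) (cmap c p))))"
    using M.transition_has_derivative[of ?d d "f p"] c d by simp
  have "((\<lambda>x. (cmap d \<circ> cinv ?d) (rep ?c ?d ((cmap ?c \<circ> cinv c) x))) has_derivative
      (\<lambda>w. coord_change ?d d (f p) (F p (coord_change c ?c p w)))) (at (cmap c p))"
    using has_derivative_compose[OF has_derivative_compose[OF 1 2] 3] .
  then have "(rep c d has_derivative (\<lambda>w. coord_change ?d d (f p) (F p (coord_change c ?c p w))))
      (at (cmap c p))"
    by (rule has_derivative_transform_within_open[where
          s="cmap c ` (cdom ?c \<inter> f -` cdom ?d \<inter> cdom c)"])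
      (use c d open_dom[of c ?d "cdom ?c"] N.open_cdom in auto)
  from frechet_derivative_apply_eq[OF this] show ?thesis
    using N.coord_change_tcoord[of c ?c p v] c by (simp add: tcoord_def)
qed

lemma rep_derivative_coord_field:
  assumes "c \<in> B" "p \<in> cdom c" "d \<in> A" "f p \<in> cdom d"
  shows "frechet_derivative (rep c d) (at (cmap c p)) w
    = tcoord A d (f p) (F p (coord_field B c w p))"
  using rep_derivative[OF assms, of "coord_field B c w p"] assms by simp

lemma along_tangent:
  assumes "c \<in> B" "d \<in> A" "x \<in> cmap c ` (f -` cdom d \<inter> cdom c)"
  shows "along c d (\<lambda>q. F q (Y q)) x = frechet_derivative (rep c d) (at x) (field_rep B c Y x)"
proof -
  obtain q where q: "q \<in> cdom c" "f q \<in> cdom d" "x = cmap c q" using assms(3) by auto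
  show ?thesis
    using rep_derivative[OF assms(1) q(1) assms(2) q(2), of "Y q"] assms(1) q by simp
qed

lemma smooth_along_tangent:
  assumes "c \<in> B" "d \<in> A" "open U" "smooth_field B U Y"
  shows "smooth_on (cmap c ` (U \<inter> f -` cdom d \<inter> cdom c)) (along c d (\<lambda>q. F q (Y q)))"
proof (rule smooth_on_cong[OF open_dom[OF assms(1-3)]])
  let ?T = "cmap c ` (U \<inter> f -` cdom d \<inter> cdom c)"
  have "smooth_on ?T (field_rep B c Y)"
    using assms unfolding smooth_field_def
    by (meson smooth_on_subset image_mono Int_mono Int_lower1 order_refl)
  then show "smooth_on ?T (\<lambda>x. frechet_derivative (rep c d) (at x) (field_rep B c Y x))"
    using smooth_on_frechet_derivative_apply[OF open_dom smooth_rep open_dom smooth_on_ident]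
      assms by blast
qed (subst along_tangent; use assms in auto)

text \<open>The components of \<open>Y\<close> solve a linear system whose coefficients are the
  Jacobian of \<open>f\<close> in charts, injective because \<open>F\<close> is, and whose
  right-hand side is smooth. This serves for \<open>tX\<close>, of which at first only the image
  \<open>\<phi> (F X)\<close> is known to be smooth.\<close>

lemma smooth_field_of_smooth_along:
  assumes inj: "\<And>p. inj (F p)"
    and along: "\<And>c d. c \<in> B \<Longrightarrow> d \<in> A \<Longrightarrow>
      smooth_on (cmap c ` (UNIV \<inter> f -` cdom d \<inter> cdom c)) (along c d (\<lambda>q. F q (Y q)))"
  shows "vector_field B Y"
proof (rule N.smooth_field_local)
  fix p :: 'n
  define c where "c = chart_at B p"
  define d where "d = chart_at A (f p)"
  have c: "c \<in> B" "p \<in> cdom c" and d: "d \<in> A" "f p \<in> cdom d" by (simp_all add: c_def d_def)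
  let ?S = "cmap c ` (f -` cdom d \<inter> cdom c)"
  have S: "open ?S" using open_dom[OF c(1) d(1), of UNIV] by simp
  have rep: "smooth_on ?S (rep c d)" using smooth_rep[OF c(1) d(1), of UNIV] by simp
  have "smooth_on ?S (field_rep B c Y)"
  proof (rule smooth_on_linear_solution[of _ "\<lambda>x. frechet_derivative (rep c d) (at x)"
          "along c d (\<lambda>q. F q (Y q))", OF S])
    show "smooth_on ?S (along c d (\<lambda>q. F q (Y q)))" using along[OF c(1) d(1)] by simp
    show "smooth_on ?S (\<lambda>x. frechet_derivative (rep c d) (at x) e)" for e
      by (rule smooth_on_derivative[OF S rep])
    fix x assume x: "x \<in> ?S"
    then obtain q where q: "f q \<in> cdom d" "q \<in> cdom c" "x = cmap c q" by auto
    show lin: "linear (frechet_derivative (rep c d) (at x))"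
      using linear_frechet_derivative smooth_on_differentiable rep x by blast
    show "frechet_derivative (rep c d) (at x) (field_rep B c Y x) = along c d (\<lambda>q. F q (Y q)) x"
      using along_tangent c d x by auto
    show "inj (frechet_derivative (rep c d) (at x))"
      unfolding linear_injective_0[OF lin]
    proof (intro allI impI)
      fix e assume "frechet_derivative (rep c d) (at x) e = 0"
      then have "tcoord A d (f q) (F q (coord_field B c e q)) = 0"
        using rep_derivative_coord_field[OF c(1) q(2) d(1) q(1)] q(3) by simp
      then have "F q (coord_field B c e q) = coord_field A d 0 (f q)"
        using M.coord_field_tcoord[OF d(1) q(1)] by metis
      also have "\<dots> = F q 0"
        using linear_0[OF M.linear_coord_field[OF d(1) q(1)]] linear_0[OF linear_F] by simp
      finally have "coord_field B c e q = 0" using inj by (auto dest: injD)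
      then have "e = tcoord B c q 0" using N.tcoord_coord_field[OF c(1) q(2)] by metis
      then show "e = 0" using linear_0[OF N.linear_tcoord[OF c(1) q(2)]] by simp
    qed
  qed
  then show "\<exists>c\<in>B. \<exists>V. open V \<and> p \<in> V \<inter> cdom c \<and>
      smooth_on (cmap c ` (V \<inter> cdom c)) (field_rep B c Y)"
    using c d(2) open_preimage[OF M.open_cdom[OF d(1)]] by blast
qed simp

section \<open>Covariant derivatives of fields along the map\<close>

definition differentiable_along :: "'n \<Rightarrow> ('n \<Rightarrow> 'a) \<Rightarrow> bool" where
  "differentiable_along p V \<longleftrightarrow>
     along (chart_at B p) (chart_at A (f p)) V differentiable at (cmap (chart_at B p) p)"

definition along_deriv :: "'n \<Rightarrow> ('n \<Rightarrow> 'a) \<Rightarrow> 'b \<Rightarrow> 'a" where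
  "along_deriv p V =
     frechet_derivative (along (chart_at B p) (chart_at A (f p)) V) (at (cmap (chart_at B p) p))"

lemma along_has_derivative:
  "differentiable_along p V \<Longrightarrow>
    (along (chart_at B p) (chart_at A (f p)) V has_derivative along_deriv p V)
      (at (cmap (chart_at B p) p))"
  by (simp add: differentiable_along_def along_deriv_def frechet_derivative_works)

lemma nabla_along_eq:
  "nabla_along B A f nabla p v V = along_deriv p V v
    + (\<Sum>b\<in>Basis. (V p \<bullet> b) *\<^sub>R nabla (f p) (F p v) (coord_field A (chart_at A (f p)) b))"
  by (simp add: nabla_along_def along_deriv_def Let_def)

lemma differentiable_along_tangent:
  "open U \<Longrightarrow> p \<in> U \<Longrightarrow> smooth_field B U Y \<Longrightarrow> differentiable_along p (\<lambda>q. F q (Y q))"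
  unfolding differentiable_along_def
  by (rule smooth_on_differentiable[OF smooth_along_tangent[of "chart_at B p" "chart_at A (f p)" U Y]])
    auto

text \<open>Differentiating the Jacobian applied to \<open>Y\<close> gives a Hessian of
  \<open>f\<close> plus the image of the derivative of \<open>Y\<close>. The Hessian is what cancels
  when two fields are exchanged.\<close>

lemma along_deriv_tangent:
  assumes U: "open U" "p \<in> U" and Y: "smooth_field B U Y"
  defines "c \<equiv> chart_at B p" and "R \<equiv> rep (chart_at B p) (chart_at A (f p))"
  shows "along_deriv p (\<lambda>q. F q (Y q)) v
    = frechet_derivative (\<lambda>x. frechet_derivative R (at x) v) (at (cmap c p)) (Y p)
      + F p (frechet_derivative (field_rep B c Y) (at (cmap c p)) v)"
proof -
  let ?d = "chart_at A (f p)" and ?x = "cmap c p"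
  let ?S = "cmap c ` (f -` cdom ?d \<inter> cdom c)"
  have c: "c \<in> B" "p \<in> cdom c" by (simp_all add: c_def)
  have S: "open ?S" "?x \<in> ?S" using open_dom[OF c(1), of ?d UNIV] c by auto
  have R: "smooth_on ?S R" using smooth_rep[OF c(1), of ?d UNIV] by (simp add: R_def c_def)
  let ?R2 = "\<lambda>w. frechet_derivative (\<lambda>x. frechet_derivative R (at x) w) (at ?x)"
  let ?DY = "frechet_derivative (field_rep B c Y) (at ?x)"
  have FR: "frechet_derivative R (at ?x) = F p"
    by (simp add: tangent_map_def R_def c_def)
  have Yx: "field_rep B c Y ?x = Y p" by (simp add: c_def)
  note DY = N.smooth_field_has_derivative[OF U(1) Y U(2) c]
  have "((\<lambda>x. (field_rep B c Y x \<bullet> b) *\<^sub>R frechet_derivative R (at x) b) has_derivative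
      (\<lambda>v. (field_rep B c Y ?x \<bullet> b) *\<^sub>R ?R2 b v + (?DY v \<bullet> b) *\<^sub>R frechet_derivative R (at ?x) b)) (at ?x)"
    for b
    by (intro has_derivative_scaleR has_derivative_inner_left DY
        smooth_on_has_derivative[OF smooth_on_derivative[OF S(1) R] S(2)])
  then have "((\<lambda>x. \<Sum>b\<in>Basis. (field_rep B c Y x \<bullet> b) *\<^sub>R frechet_derivative R (at x) b) has_derivative
      (\<lambda>v. \<Sum>b\<in>Basis. (Y p \<bullet> b) *\<^sub>R ?R2 b v + (?DY v \<bullet> b) *\<^sub>R F p b)) (at ?x)"
    unfolding FR Yx by (intro has_derivative_sum)
  then have "(along c ?d (\<lambda>q. F q (Y q)) has_derivative
      (\<lambda>v. \<Sum>b\<in>Basis. (Y p \<bullet> b) *\<^sub>R ?R2 b v + (?DY v \<bullet> b) *\<^sub>R F p b)) (at ?x)"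
  proof (rule has_derivative_transform_within_open[OF _ S])
    fix x assume x: "x \<in> ?S"
    then have "linear (frechet_derivative R (at x))"
      using R linear_frechet_derivative smooth_on_differentiable by blast
    note lin = linear_basis_expansion[OF this, of "field_rep B c Y x"]
    show "(\<Sum>b\<in>Basis. (field_rep B c Y x \<bullet> b) *\<^sub>R frechet_derivative R (at x) b)
        = along c ?d (\<lambda>q. F q (Y q)) x"
      unfolding along_tangent[OF c(1) M.chart_at_in x] lin[symmetric]
      by (simp add: R_def c_def)
  qed
  then have "along_deriv p (\<lambda>q. F q (Y q)) v
      = (\<Sum>b\<in>Basis. (Y p \<bullet> b) *\<^sub>R ?R2 b v + (?DY v \<bullet> b) *\<^sub>R F p b)"
    unfolding along_deriv_def c_def[symmetric] by (rule frechet_derivative_apply_eq)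
  \<comment> \<open>\<open>?R2 b v\<close> is linear in the outer direction \<open>v\<close> by
    construction; exchanging the two arguments puts the summation index there, and the sum collapses
    to one value.\<close>
  also have "\<dots> = (\<Sum>b\<in>Basis. (Y p \<bullet> b) *\<^sub>R ?R2 v b) + (\<Sum>b\<in>Basis. (?DY v \<bullet> b) *\<^sub>R F p b)"
    by (simp add: sum.distrib second_derivative_symmetric[OF S R, of _ v])
  also have "(\<Sum>b\<in>Basis. (?DY v \<bullet> b) *\<^sub>R F p b) = F p (?DY v)"
    by (rule linear_basis_expansion[OF linear_F, symmetric])
  also have "(\<Sum>b\<in>Basis. (Y p \<bullet> b) *\<^sub>R ?R2 v b) = ?R2 v (Y p)"
    by (intro linear_basis_expansion[symmetric] linear_frechet_derivative
        smooth_on_differentiable[OF smooth_on_derivative[OF S(1) R] S(2)])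
  finally show ?thesis .
qed

end

section \<open>The pulled-back connection: torsion, metric and structure equation\<close>

locale gqs_submanifold = smooth_manifold_map B A f + M: gqs_manifold A \<phi> \<xi> \<eta> g nabla
  for B :: "('n::{t2_space, second_countable_topology}, 'b::euclidean_space) atlas"
    and A :: "('m::{t2_space, second_countable_topology}, 'a::euclidean_space) atlas"
    and f :: "'n \<Rightarrow> 'm" and \<phi> :: "'m \<Rightarrow> 'a \<Rightarrow> 'a" and \<xi> :: "'m \<Rightarrow> 'a"
    and \<eta> :: "'m \<Rightarrow> 'a \<Rightarrow> real" and g :: "('m, 'a) metric_tensor" and nabla :: "('m, 'a) conn"
begin

abbreviation Dv where "Dv \<equiv> nabla_along B A f nabla"

text \<open>The Hessian terms of \<open>f\<close> cancel by symmetry of second derivatives, the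
  Christoffel terms by the vanishing torsion of \<open>nabla\<close>; the derivatives of the
  components remain and form the bracket.\<close>

lemma torsion_along:
  assumes U: "open U" "p \<in> U" and X: "smooth_field B U X" and Y: "smooth_field B U Y"
  shows "Dv p (X p) (\<lambda>q. F q (Y q)) - Dv p (Y p) (\<lambda>q. F q (X q)) = F p (lie_bracket B X Y p)"
proof -
  define c where "c = chart_at B p"
  define d where "d = chart_at A (f p)"
  define R where "R = rep c d"
  have c: "c \<in> B" "p \<in> cdom c" and d: "d \<in> A" "f p \<in> cdom d" by (simp_all add: c_def d_def)
  let ?S = "cmap c ` (f -` cdom d \<inter> cdom c)"
  have S: "open ?S" "cmap c p \<in> ?S" using open_dom[OF c(1) d(1), of UNIV] c d by auto
  have R: "smooth_on ?S R" using smooth_rep[OF c(1) d(1), of UNIV] by (simp add: R_def)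
  have E: "nabla (f p) u (coord_field A d b) = nabla (f p) b (coord_field A d u)" for u b
    by (rule M.nabla_coord_field_commute) (simp add: d_def)
  have lin: "linear (\<lambda>v. nabla (f p) v (coord_field A d b))" for b
    by (rule M.linear_nabla[OF M.open_cdom M.smooth_field_coord_field]) (use d in auto)
  \<comment> \<open>\<open>nabla\<close> is linear in its direction; the symmetry \<open>E\<close>
    moves the summation index into that slot, so the sum contracts.\<close>
  have sum: "(\<Sum>b\<in>Basis. (w \<bullet> b) *\<^sub>R nabla (f p) v (coord_field A d b)) = nabla (f p) w (coord_field A d v)"
    for v w
    unfolding E[of v] using linear_basis_expansion[OF lin, symmetric] by simp
  note deriv = along_deriv_tangent[OF U, folded c_def, folded d_def, folded R_def]
  have "Dv p (X p) (\<lambda>q. F q (Y q)) - Dv p (Y p) (\<lambda>q. F q (X q))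
    = F p (frechet_derivative (field_rep B c Y) (at (cmap c p)) (X p))
      - F p (frechet_derivative (field_rep B c X) (at (cmap c p)) (Y p))"
    unfolding nabla_along_eq d_def[symmetric] deriv[OF X] deriv[OF Y] sum
    using second_derivative_symmetric[OF S R, of "X p" "Y p"] E[of "F p (X p)" "F p (Y p)"] by simp
  then show ?thesis
    by (simp add: lie_bracket_def Let_def linear_diff[OF linear_F] flip: c_def)
qed

text \<open>In coordinates the function is a double sum of components of \<open>V\<close> and
  \<open>W\<close> times the metric coefficients \<open>G b b'\<close> composed with
  \<open>f\<close>. Its derivative needs compatibility of \<open>nabla\<close> only for coordinate
  fields, and bilinearity regroups the result into the two covariant derivatives.\<close>

lemma metric_along:
  assumes V: "differentiable_along p V" and W: "differentiable_along p W"
  shows "dir_deriv B p v (\<lambda>q. g (f q) (V q) (W q))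
    = g (f p) (Dv p v V) (W p) + g (f p) (V p) (Dv p v W)"
proof -
  define c where "c = chart_at B p"
  define d where "d = chart_at A (f p)"
  have c: "c \<in> B" "p \<in> cdom c" and d: "d \<in> A" "f p \<in> cdom d" by (simp_all add: c_def d_def)
  let ?x = "cmap c p" and ?S = "cmap c ` (f -` cdom d \<inter> cdom c)"
  let ?E = "coord_field A d"
  let ?n = "\<lambda>b. nabla (f p) (F p v) (?E b)"
  define G where "G b b' q = g q (?E b q) (?E b' q)" for b b' q
  have S: "open ?S" "?x \<in> ?S" using open_dom[OF c(1) d(1), of UNIV] c d by auto
  note oc = M.open_cdom[OF d(1)] and sE = M.smooth_field_coord_field[OF d(1)]
  have "smooth_fun A (cdom d) (G b b')" for b b'
    unfolding G_def[abs_def] using M.smooth_metric[OF oc sE sE] .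
  then have "smooth_on (cmap d ` (cdom d \<inter> cdom d)) (G b b' \<circ> cinv d)" for b b'
    unfolding smooth_fun_def using d by blast
  then have "((G b b' \<circ> cinv d) has_derivative (\<lambda>w. dir_deriv A (f p) w (G b b'))) (at (cmap d (f p)))"
    for b b'
    using smooth_on_has_derivative d by (fastforce simp: dir_deriv_def simp flip: d_def)
  moreover have "dir_deriv A (f p) w (G b b')
      = g (f p) (nabla (f p) w (?E b)) b' + g (f p) b (nabla (f p) w (?E b'))" for w b b'
    unfolding G_def[abs_def] using M.metric_compatible[OF oc sE sE d(2)] by (simp add: d_def)
  moreover have "cmap d (f p) = rep c d ?x" using c by simp
  ultimately have dG: "((G b b' \<circ> cinv d) has_derivative
      (\<lambda>w. g (f p) (nabla (f p) w (?E b)) b' + g (f p) b (nabla (f p) w (?E b')))) (at (rep c d ?x))" for b b'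
    by simp
  have dR: "(rep c d has_derivative F p) (at ?x)"
    using tangent_map_has_derivative by (simp add: c_def d_def)
  have x: "along c d V ?x = V p" "along c d W ?x = W p"
    "(G b b' \<circ> cinv d) (rep c d ?x) = g (f p) b b'" for b b'
    using c d by (simp_all add: G_def) (simp_all add: d_def)
  note dV = along_has_derivative[OF V, folded c_def d_def]
    and dW = along_has_derivative[OF W, folded c_def d_def]
  have "((\<lambda>x. (along c d V x \<bullet> b) *\<^sub>R (along c d W x \<bullet> b') *\<^sub>R (G b b' \<circ> cinv d) (rep c d x))
      has_derivative (\<lambda>v. (along c d V ?x \<bullet> b) *\<^sub>R ((along c d W ?x \<bullet> b') *\<^sub>R
          (g (f p) (nabla (f p) (F p v) (?E b)) b' + g (f p) b (nabla (f p) (F p v) (?E b')))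
          + (along_deriv p W v \<bullet> b') *\<^sub>R (G b b' \<circ> cinv d) (rep c d ?x))
        + (along_deriv p V v \<bullet> b) *\<^sub>R ((along c d W ?x \<bullet> b') *\<^sub>R (G b b' \<circ> cinv d) (rep c d ?x)))) (at ?x)"
    for b b'
    by (intro has_derivative_scaleR has_derivative_inner_left dV dW has_derivative_compose[OF dR dG])
  then have "((\<lambda>x. \<Sum>b\<in>Basis. \<Sum>b'\<in>Basis.
        (along c d V x \<bullet> b) *\<^sub>R (along c d W x \<bullet> b') *\<^sub>R (G b b' \<circ> cinv d) (rep c d x))
      has_derivative (\<lambda>v. \<Sum>b\<in>Basis. \<Sum>b'\<in>Basis. (V p \<bullet> b) *\<^sub>R ((W p \<bullet> b') *\<^sub>R
          (g (f p) (nabla (f p) (F p v) (?E b)) b' + g (f p) b (nabla (f p) (F p v) (?E b')))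
          + (along_deriv p W v \<bullet> b') *\<^sub>R g (f p) b b')
        + (along_deriv p V v \<bullet> b) *\<^sub>R ((W p \<bullet> b') *\<^sub>R g (f p) b b'))) (at ?x)"
    unfolding x by (intro has_derivative_sum)
  then have "(((\<lambda>q. g (f q) (V q) (W q)) \<circ> cinv c)
      has_derivative (\<lambda>v. \<Sum>b\<in>Basis. \<Sum>b'\<in>Basis. (V p \<bullet> b) *\<^sub>R ((W p \<bullet> b') *\<^sub>R
          (g (f p) (nabla (f p) (F p v) (?E b)) b' + g (f p) b (nabla (f p) (F p v) (?E b')))
          + (along_deriv p W v \<bullet> b') *\<^sub>R g (f p) b b')
        + (along_deriv p V v \<bullet> b) *\<^sub>R ((W p \<bullet> b') *\<^sub>R g (f p) b b'))) (at ?x)"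
  proof (rule has_derivative_transform_within_open[OF _ S])
    fix x assume "x \<in> ?S"
    then obtain q where q: "q \<in> cdom c" "f q \<in> cdom d" "x = cmap c q" by auto
    have "g (f q) (V q) (W q) = (\<Sum>b\<in>Basis. \<Sum>b'\<in>Basis. (tcoord A d (f q) (V q) \<bullet> b) *\<^sub>R
        (tcoord A d (f q) (W q) \<bullet> b') *\<^sub>R g (f q) (?E b (f q)) (?E b' (f q)))"
      unfolding bilinear_sum_scaleR[OF M.bilinear_metric, symmetric]
      using M.coord_field_expansion[OF d(1) q(2)] by metis
    then show "(\<Sum>b\<in>Basis. \<Sum>b'\<in>Basis.
        (along c d V x \<bullet> b) *\<^sub>R (along c d W x \<bullet> b') *\<^sub>R (G b b' \<circ> cinv d) (rep c d x))
      = ((\<lambda>q. g (f q) (V q) (W q)) \<circ> cinv c) x"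
      using c d q by (simp add: G_def)
  qed
  then have "dir_deriv B p v (\<lambda>q. g (f q) (V q) (W q)) = (\<Sum>b\<in>Basis. \<Sum>b'\<in>Basis. (V p \<bullet> b) *\<^sub>R
        ((W p \<bullet> b') *\<^sub>R (g (f p) (?n b) b' + g (f p) b (?n b'))
          + (along_deriv p W v \<bullet> b') *\<^sub>R g (f p) b b')
        + (along_deriv p V v \<bullet> b) *\<^sub>R ((W p \<bullet> b') *\<^sub>R g (f p) b b'))"
    unfolding dir_deriv_def c_def[symmetric] by (rule frechet_derivative_apply_eq)
  also have "\<dots> = (g (f p) (along_deriv p V v) (W p) + g (f p) (\<Sum>b\<in>Basis. (V p \<bullet> b) *\<^sub>R ?n b) (W p))
      + (g (f p) (V p) (along_deriv p W v) + g (f p) (V p) (\<Sum>b\<in>Basis. (W p \<bullet> b) *\<^sub>R ?n b))"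
  proof -
    \<comment> \<open>Each of the four summands on the right becomes a double sum over pairs of
      basis vectors, which reduces the identity to a comparison of coefficients.\<close>
    note exp = bilinear_sum_scaleR[OF M.bilinear_metric[of "f p"], of _ _ Basis _ _ Basis]
    have "g (f p) (along_deriv p V v) (W p)
        = (\<Sum>b\<in>Basis. \<Sum>b'\<in>Basis. (along_deriv p V v \<bullet> b) *\<^sub>R (W p \<bullet> b') *\<^sub>R g (f p) b b')"
      "g (f p) (V p) (along_deriv p W v)
        = (\<Sum>b\<in>Basis. \<Sum>b'\<in>Basis. (V p \<bullet> b) *\<^sub>R (along_deriv p W v \<bullet> b') *\<^sub>R g (f p) b b')"
      "g (f p) (\<Sum>b\<in>Basis. (V p \<bullet> b) *\<^sub>R ?n b) (W p)
        = (\<Sum>b\<in>Basis. \<Sum>b'\<in>Basis. (V p \<bullet> b) *\<^sub>R (W p \<bullet> b') *\<^sub>R g (f p) (?n b) b')"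
      "g (f p) (V p) (\<Sum>b\<in>Basis. (W p \<bullet> b) *\<^sub>R ?n b)
        = (\<Sum>b\<in>Basis. \<Sum>b'\<in>Basis. (V p \<bullet> b) *\<^sub>R (W p \<bullet> b') *\<^sub>R g (f p) b (?n b'))"
      by (simp_all only: exp[symmetric] euclidean_representation)
    then show ?thesis by (simp add: sum.distrib algebra_simps)
  qed
  also have "\<dots> = g (f p) (Dv p v V) (W p) + g (f p) (V p) (Dv p v W)"
    by (simp only: nabla_along_eq d_def M.metric_simps)
  finally show ?thesis .
qed

text \<open>The column of the matrix of \<open>\<phi>\<close> in the chart \<open>d\<close> that
  belongs to \<open>b\<close>.\<close>

abbreviation phi_rep where
  "phi_rep d b \<equiv> field_rep A d (\<lambda>q. \<phi> q (coord_field A d b q))"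

lemma along_phi:
  assumes "c \<in> B" "d \<in> A" "x \<in> cmap c ` (f -` cdom d \<inter> cdom c)"
  shows "along c d (\<lambda>q. \<phi> (f q) (V q)) x
    = (\<Sum>b\<in>Basis. (along c d V x \<bullet> b) *\<^sub>R phi_rep d b (rep c d x))"
proof -
  obtain q where q: "q \<in> cdom c" "f q \<in> cdom d" "x = cmap c q" using assms(3) by auto
  have "linear (\<lambda>w. tcoord A d (f q) (\<phi> (f q) (coord_field A d w (f q))))"
    using linear_compose[OF linear_compose[OF M.linear_coord_field M.linear_phi] M.linear_tcoord]
      assms q by (simp add: o_def)
  from linear_basis_expansion[OF this, of "tcoord A d (f q) (V q)"] show ?thesis
    using assms q by (simp add: M.coord_field_tcoord)
qed

lemma smooth_phi_rep:
  "d \<in> A \<Longrightarrow> smooth_on (cmap d ` cdom d) (phi_rep d b)"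
  using M.smooth_phi[OF M.open_cdom M.smooth_field_coord_field, of d]
  by (force simp: smooth_field_def)

lemma smooth_along_phi:
  assumes c: "c \<in> B" and d: "d \<in> A" and U: "open U"
    and V: "smooth_on (cmap c ` (U \<inter> f -` cdom d \<inter> cdom c)) (along c d V)"
  shows "smooth_on (cmap c ` (U \<inter> f -` cdom d \<inter> cdom c)) (along c d (\<lambda>q. \<phi> (f q) (V q)))"
proof (rule smooth_on_cong[OF open_dom[OF c d U]])
  have "rep c d ` (cmap c ` (U \<inter> f -` cdom d \<inter> cdom c)) \<subseteq> cmap d ` cdom d"
    using c by auto
  then show "smooth_on (cmap c ` (U \<inter> f -` cdom d \<inter> cdom c))
      (\<lambda>x. \<Sum>b\<in>Basis. (along c d V x \<bullet> b) *\<^sub>R phi_rep d b (rep c d x))"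
    by (intro smooth_on_sum smooth_on_scaleR smooth_on_linear_compose[OF linear_inner_const] V
        smooth_on_compose[OF smooth_phi_rep smooth_rep] c d finite_Basis)
qed (subst along_phi; use c d in auto)

text \<open>Linearity of \<open>\<phi>\<close> reduces the claim to coordinate fields, where the
  structure equation is available; the Christoffel terms of \<open>\<phi> V\<close> cancel against
  those contained in the derivative of the matrix of \<open>\<phi>\<close>.\<close>

lemma nabla_along_phi:
  assumes V: "differentiable_along p V"
  shows "Dv p v (\<lambda>q. \<phi> (f q) (V q)) - \<phi> (f p) (Dv p v V)
    = g (f p) (nabla (f p) (\<phi> (f p) (F p v)) \<xi>) (V p) *\<^sub>R \<xi> (f p)
      - \<eta> (f p) (V p) *\<^sub>R nabla (f p) (\<phi> (f p) (F p v)) \<xi>"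
proof -
  define c where "c = chart_at B p"
  define d where "d = chart_at A (f p)"
  have c: "c \<in> B" "p \<in> cdom c" and d: "d \<in> A" "f p \<in> cdom d" by (simp_all add: c_def d_def)
  let ?x = "cmap c p" and ?S = "cmap c ` (f -` cdom d \<inter> cdom c)"
  let ?n = "\<lambda>b. nabla (f p) (F p v) (coord_field A d b)" and ?\<phi> = "\<phi> (f p)"
  let ?N = "nabla (f p) (?\<phi> (F p v)) \<xi>"
  let ?\<Phi> = "\<lambda>b. frechet_derivative (phi_rep d b) (at (cmap d (f p)))"
  note linear_phi = M.linear_phi[of "f p"]
  have S: "open ?S" "?x \<in> ?S" using open_dom[OF c(1) d(1), of UNIV] c d by auto
  have x: "along c d V ?x = V p" "phi_rep d b (rep c d ?x) = ?\<phi> b" for b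
    using c d by simp_all (simp_all add: d_def)
  have dR: "(rep c d has_derivative F p) (at ?x)"
    using tangent_map_has_derivative by (simp add: c_def d_def)
  have "(phi_rep d b has_derivative ?\<Phi> b) (at (rep c d ?x))" for b
    using smooth_on_has_derivative[OF smooth_phi_rep[OF d(1)]] c d by simp
  then have "((\<lambda>x. (along c d V x \<bullet> b) *\<^sub>R phi_rep d b (rep c d x)) has_derivative
      (\<lambda>v. (along c d V ?x \<bullet> b) *\<^sub>R ?\<Phi> b (F p v) + (along_deriv p V v \<bullet> b) *\<^sub>R phi_rep d b (rep c d ?x)))
      (at ?x)" for b
    by (intro has_derivative_scaleR has_derivative_inner_left has_derivative_compose[OF dR]
        along_has_derivative[OF V, folded c_def d_def])
  then have "((\<lambda>x. \<Sum>b\<in>Basis. (along c d V x \<bullet> b) *\<^sub>R phi_rep d b (rep c d x)) has_derivative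
      (\<lambda>v. \<Sum>b\<in>Basis. (V p \<bullet> b) *\<^sub>R ?\<Phi> b (F p v) + (along_deriv p V v \<bullet> b) *\<^sub>R ?\<phi> b)) (at ?x)"
    unfolding x by (intro has_derivative_sum)
  then have "(along c d (\<lambda>q. \<phi> (f q) (V q)) has_derivative
      (\<lambda>v. \<Sum>b\<in>Basis. (V p \<bullet> b) *\<^sub>R ?\<Phi> b (F p v) + (along_deriv p V v \<bullet> b) *\<^sub>R ?\<phi> b)) (at ?x)"
    by (rule has_derivative_transform_within_open[OF _ S]) (rule along_phi[OF c(1) d(1), symmetric])
  then have 1: "along_deriv p (\<lambda>q. \<phi> (f q) (V q)) v
      = (\<Sum>b\<in>Basis. (V p \<bullet> b) *\<^sub>R ?\<Phi> b (F p v) + (along_deriv p V v \<bullet> b) *\<^sub>R ?\<phi> b)"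
    unfolding along_deriv_def c_def[symmetric] d_def[symmetric] by (rule frechet_derivative_apply_eq)
  \<comment> \<open>The coordinate formula for \<open>nabla\<close>, solved for the ordinary
    derivative of a column of \<open>\<phi>\<close>.\<close>
  have 2: "?\<Phi> b (F p v) = nabla (f p) (F p v) (\<lambda>q. \<phi> q (coord_field A d b q))
      - (\<Sum>e\<in>Basis. (?\<phi> b \<bullet> e) *\<^sub>R ?n e)" for b
    using M.nabla_coordinates[OF M.open_cdom[OF d(1)] d(2)
        M.smooth_phi[OF M.open_cdom[OF d(1)] M.smooth_field_coord_field[OF d(1)]],
        folded d_def, of "F p v" b] by (simp add: d_def)
  have 3: "nabla (f p) (F p v) (\<lambda>q. \<phi> q (coord_field A d b q)) = ?\<phi> (?n b)
      + (g (f p) ?N b *\<^sub>R \<xi> (f p) - \<eta> (f p) b *\<^sub>R ?N)" for b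
    using M.gqs_coord_field[OF d_def, of "F p v" b] by (simp add: algebra_simps)
  have 4: "(\<Sum>b\<in>Basis. (V p \<bullet> b) *\<^sub>R (\<Sum>e\<in>Basis. (?\<phi> b \<bullet> e) *\<^sub>R ?n e)) = (\<Sum>e\<in>Basis. (?\<phi> (V p) \<bullet> e) *\<^sub>R ?n e)"
  proof -
    have "linear (\<lambda>w. \<Sum>e\<in>Basis. (?\<phi> w \<bullet> e) *\<^sub>R ?n e)"
      by (intro linear_compose_sum ballI linearI)
        (simp_all add: linear_add[OF linear_phi] linear_cmul[OF linear_phi] inner_add_left scaleR_left_distrib)
    from linear_basis_expansion[OF this, symmetric] show ?thesis .
  qed
  have 5: "(\<Sum>b\<in>Basis. (V p \<bullet> b) *\<^sub>R (g (f p) ?N b *\<^sub>R \<xi> (f p) - \<eta> (f p) b *\<^sub>R ?N))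
      = g (f p) ?N (V p) *\<^sub>R \<xi> (f p) - \<eta> (f p) (V p) *\<^sub>R ?N"
  proof -
    have "linear (\<lambda>w. g (f p) ?N w *\<^sub>R \<xi> (f p) - \<eta> (f p) w *\<^sub>R ?N)"
      by (rule linearI) (simp_all add: M.eta_eq M.metric_simps algebra_simps)
    from linear_basis_expansion[OF this, symmetric] show ?thesis .
  qed
  have "?\<phi> (Dv p v V) = ?\<phi> (along_deriv p V v) + (\<Sum>b\<in>Basis. (V p \<bullet> b) *\<^sub>R ?\<phi> (?n b))"
    by (simp add: nabla_along_eq linear_add[OF linear_phi] linear_sum[OF linear_phi]
        linear_cmul[OF linear_phi] flip: d_def)
  moreover have "Dv p v (\<lambda>q. \<phi> (f q) (V q)) = ?\<phi> (along_deriv p V v)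
      + (\<Sum>b\<in>Basis. (V p \<bullet> b) *\<^sub>R ?\<phi> (?n b))
      + (\<Sum>b\<in>Basis. (V p \<bullet> b) *\<^sub>R (g (f p) ?N b *\<^sub>R \<xi> (f p) - \<eta> (f p) b *\<^sub>R ?N))"
    unfolding nabla_along_eq d_def[symmetric] 1 2 3
    by (simp add: sum.distrib scaleR_right_distrib scaleR_right_diff_distrib sum_subtractf 4
        linear_basis_expansion[OF linear_phi, symmetric])
  ultimately show ?thesis unfolding 5 by simp
qed

end

section \<open>Semi-invariant submanifolds\<close>

locale semi_invariant_submanifold =
  gqs_submanifold B A f \<phi> \<xi> \<eta> g nabla + N: levi_civita_connection B nabla' "induced_metric B A f g"
  for B :: "('n::{t2_space, second_countable_topology}, 'b::euclidean_space) atlas"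
    and A :: "('m::{t2_space, second_countable_topology}, 'a::euclidean_space) atlas"
    and f :: "'n \<Rightarrow> 'm" and \<phi> :: "'m \<Rightarrow> 'a \<Rightarrow> 'a" and \<xi> :: "'m \<Rightarrow> 'a"
    and \<eta> :: "'m \<Rightarrow> 'a \<Rightarrow> real" and g :: "('m, 'a) metric_tensor" and nabla :: "('m, 'a) conn"
    and nabla' :: "('n, 'b) conn" +
  fixes D D' :: "'n \<Rightarrow> 'b set"
  assumes semi_invariant: "semi_invariant_xi_perp B A f \<phi> \<xi> g D D'"
begin

abbreviation h where "h \<equiv> second_ff B A f nabla nabla'"
abbreviation normal where "normal \<equiv> normal_vec B A f g"
abbreviation t where "t \<equiv> t_part B A f \<phi> g D"

section \<open>Symmetry and normality of the second fundamental form\<close>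

lemma second_ff_eq: "h X Y p = Dv p (X p) (\<lambda>q. F q (Y q)) - F p (nabla' p (X p) Y)"
  by (simp add: second_ff_def)

text \<open>The torsion identities of both connections produce the same vector
  \<open>F [X, Y]\<close>, which drops out of the difference.\<close>

lemma second_ff_symmetric:
  assumes U: "open U" "p \<in> U" and X: "smooth_field B U X" and Y: "smooth_field B U Y"
  shows "h X Y p = h Y X p"
  using torsion_along[OF U X Y] N.torsion_free[OF U(1) X Y U(2)]
  by (simp add: second_ff_eq linear_add[OF linear_F] algebra_simps)

text \<open>The inner product of \<open>F Y\<close> and \<open>F Z\<close> is differentiated in two
  ways, by the pulled-back connection and by \<open>nabla'\<close>; both are metric, and the two
  results are compared.\<close>

lemma second_ff_skew:
  assumes U: "open U" "p \<in> U" and Y: "smooth_field B U Y" and Z: "smooth_field B U Z"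
  shows "g (f p) (h X Y p) (F p (Z p)) = - g (f p) (h X Z p) (F p (Y p))"
proof -
  have "g (f p) (Dv p (X p) (\<lambda>q. F q (Y q))) (F p (Z p)) + g (f p) (F p (Y p)) (Dv p (X p) (\<lambda>q. F q (Z q)))
      = g (f p) (F p (nabla' p (X p) Y)) (F p (Z p)) + g (f p) (F p (Y p)) (F p (nabla' p (X p) Z))"
    using metric_along[OF differentiable_along_tangent[OF U Y] differentiable_along_tangent[OF U Z]]
      N.metric_compatible[OF U(1) Y Z U(2)] by (simp add: induced_metric_def)
  then show ?thesis
    by (simp add: second_ff_eq M.metric_simps M.metric_sym[of _ "F p (Y p)"])
qed

lemma second_ff_normal:
  assumes U: "open U" "p \<in> U" and X: "smooth_field B U X" and Y: "smooth_field B U Y"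
  shows "normal p (h X Y p)"
  unfolding normal_vec_def
proof
  fix v
  let ?c = "chart_at B p"
  \<comment> \<open>\<open>v\<close> is extended with constant components in the chart, so all three
    fields are smooth on \<open>?W\<close> and the identities for fields apply.\<close>
  let ?W = "U \<inter> cdom ?c" and ?Z = "coord_field B ?c v"
  have W: "open ?W" "p \<in> ?W" using open_Int[OF U(1) N.open_cdom[of ?c]] U by auto
  have sX: "smooth_field B ?W X" and sY: "smooth_field B ?W Y"
    using N.smooth_field_subset X Y by blast+
  have sZ: "smooth_field B ?W ?Z"
    using N.smooth_field_subset[OF N.smooth_field_coord_field[of ?c]] by auto
  \<comment> \<open>Symmetric in the first two arguments and skew in the last two, hence zero.\<close>
  let ?S = "\<lambda>X Y Z. g (f p) (h X Y p) (F p (Z p))"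
  note sym = second_ff_symmetric[OF W] and skew = second_ff_skew[OF W]
  have "?S X Y ?Z = - ?S Y ?Z X" using sym[OF sX sY] skew[OF sX sZ, of Y] by simp
  also have "\<dots> = ?S ?Z X Y" using sym[OF sY sZ] skew[OF sY sX, of ?Z] by simp
  also have "\<dots> = - ?S X Y ?Z" using sym[OF sZ sX] skew[OF sZ sY, of X] by simp
  finally have "?S X Y ?Z = 0" by simp
  then show "g (f p) (h X Y p) (F p v) = 0" by simp
qed

section \<open>The splitting of the tangent bundle and the map \<open>t\<close>\<close>

lemma xi_normal: "g (f p) (F p v) (\<xi> (f p)) = 0"
  and inj_F: "inj (F p)"
  and D_sum: "\<exists>a\<in>D p. \<exists>b\<in>D' p. v = a + b"
  and phi_D: "v \<in> D p \<Longrightarrow> \<exists>w\<in>D p. \<phi> (f p) (F p v) = F p w"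
  and phi_D': "v \<in> D' p \<Longrightarrow> normal p (\<phi> (f p) (F p v))"
proof -
  have "normal p (\<xi> (f p))" using semi_invariant by (simp add: semi_invariant_xi_perp_def)
  then show "g (f p) (F p v) (\<xi> (f p)) = 0"
    by (simp add: normal_vec_def M.metric_sym[of _ "F p v"])
  show "inj (F p)"
    using semi_invariant by (simp add: semi_invariant_xi_perp_def immersion_def)
  have "{v + w |v w. v \<in> D p \<and> w \<in> D' p} = UNIV"
    using semi_invariant by (simp add: semi_invariant_xi_perp_def)
  then have "v \<in> {v + w |v w. v \<in> D p \<and> w \<in> D' p}" by (simp only: UNIV_I)
  then show "\<exists>a\<in>D p. \<exists>b\<in>D' p. v = a + b" by blast
  have "\<phi> (f p) ` F p ` D p = F p ` D p"
    using semi_invariant by (simp add: semi_invariant_xi_perp_def)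
  then show "v \<in> D p \<Longrightarrow> \<exists>w\<in>D p. \<phi> (f p) (F p v) = F p w" by blast
  show "v \<in> D' p \<Longrightarrow> normal p (\<phi> (f p) (F p v))"
    using semi_invariant by (simp add: semi_invariant_xi_perp_def)
qed

lemma normal_tangent_zero: "normal p (F p v) \<Longrightarrow> F p v = 0"
  using M.metric_pos[of "F p v" "f p"] by (force simp: normal_vec_def)

lemma normal_diff: "normal p v \<Longrightarrow> normal p w \<Longrightarrow> normal p (v - w)"
  by (simp add: normal_vec_def M.metric_simps)

lemma normal_scaled_xi: "normal p (r *\<^sub>R \<xi> (f p))"
  by (simp add: normal_vec_def M.metric_simps M.metric_sym[of _ "\<xi> (f p)"] xi_normal)

lemma eta_F: "\<eta> (f p) (F p v) = 0"
  by (simp add: M.eta_eq xi_normal)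

text \<open>On \<open>D\<close> the image under \<open>\<phi>\<close> is itself tangent, so the
  normal part is 0; uniqueness in the definite description comes from positivity of the metric and
  injectivity of \<open>F\<close>.\<close>

lemma t_in_D: "v \<in> D p \<Longrightarrow> t p v \<in> D p"
  and F_t: "v \<in> D p \<Longrightarrow> F p (t p v) = \<phi> (f p) (F p v)"
proof -
  assume "v \<in> D p"
  then obtain w where w: "w \<in> D p" "\<phi> (f p) (F p v) = F p w" using phi_D by blast
  have "t p v = w"
    unfolding t_part_def
  proof (rule the_equality)
    show "w \<in> D p \<and> normal p (\<phi> (f p) (F p v) - F p w)"
      using w by (simp add: normal_vec_def M.metric_simps)
    fix w' assume "w' \<in> D p \<and> normal p (\<phi> (f p) (F p v) - F p w')"
    then have "F p w' = F p w"
      using w normal_tangent_zero[of p "w - w'"] by (simp add: linear_diff[OF linear_F])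
    then show "w' = w" by (rule injD[OF inj_F])
  qed
  with w show "t p v \<in> D p" "F p (t p v) = \<phi> (f p) (F p v)" by auto
qed

lemma section_t:
  assumes X: "section_of B D X"
  shows "section_of B D (\<lambda>q. t q (X q))"
proof -
  have XD: "X q \<in> D q" for q using X by (simp add: section_of_def)
  have "vector_field B (\<lambda>q. t q (X q))"
  proof (rule smooth_field_of_smooth_along)
    fix c d assume "c \<in> B" "d \<in> A"
    then show "smooth_on (cmap c ` (UNIV \<inter> f -` cdom d \<inter> cdom c)) (along c d (\<lambda>q. F q (t q (X q))))"
      unfolding F_t[OF XD]
      using X by (intro smooth_along_phi smooth_along_tangent) (auto simp: section_of_def)
  qed (rule inj_F)
  then show ?thesis by (simp add: section_of_def t_in_D XD)
qed

text \<open>Expresses the bracket by operations known to preserve smoothness of fields, which avoids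
  a computation in charts.\<close>

lemma lie_bracket_eq:
  assumes "vector_field B X" "vector_field B Y"
  shows "lie_bracket B X Y = (\<lambda>p. nabla' p (X p) Y + (-1) *\<^sub>R nabla' p (Y p) X)"
  using N.torsion_free[OF open_UNIV assms] by (simp add: fun_eq_iff)

lemma smooth_lie_bracket:
  assumes "vector_field B X" "vector_field B Y"
  shows "vector_field B (lie_bracket B X Y)"
  unfolding lie_bracket_eq[OF assms]
  by (intro N.smooth_field_add N.smooth_field_scaleR N.smooth_fun_const N.smooth_field_nabla
      open_UNIV assms)

section \<open>The obstruction to closure of \<open>D\<close> under brackets\<close>

definition defect where
  "defect X Y p = h (\<lambda>q. t q (X q)) Y p - h X (\<lambda>q. t q (Y q)) p
    - lie_deriv_metric A \<xi> g (f p) (F p (X p)) (\<phi> (f p) (F p (Y p))) *\<^sub>R \<xi> (f p)"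

lemma defect_normal:
  assumes X: "section_of B D X" and Y: "section_of B D Y"
  shows "normal p (defect X Y p)"
  unfolding defect_def
  using X Y section_t[OF X] section_t[OF Y]
  by (intro normal_diff second_ff_normal[of UNIV] normal_scaled_xi) (auto simp: section_of_def)

text \<open>The structure equation is applied to \<open>tX\<close> and \<open>tY\<close>. Its two
  multiples of \<open>\<xi>\<close> combine to exactly the Lie derivative term, so no multiple of
  \<open>\<xi>\<close> is left outside the image of the bracket under \<open>\<phi>\<close>.\<close>

lemma defect_eq:
  assumes X: "section_of B D X" and Y: "section_of B D Y"
  shows "defect X Y p = F p (nabla' p (X p) (\<lambda>q. t q (Y q)) - nabla' p (Y p) (\<lambda>q. t q (X q)))
    - \<phi> (f p) (F p (lie_bracket B X Y p))"
proof -
  let ?x = "F p (X p)" and ?y = "F p (Y p)" and ?\<phi> = "\<phi> (f p)"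
  have sX: "vector_field B X" and sY: "vector_field B Y"
    and stX: "vector_field B (\<lambda>q. t q (X q))" and stY: "vector_field B (\<lambda>q. t q (Y q))"
    and XD: "\<And>q. X q \<in> D q" and YD: "\<And>q. Y q \<in> D q"
    using X Y section_t[OF X] section_t[OF Y] by (auto simp: section_of_def)
  note diff = differentiable_along_tangent[OF open_UNIV UNIV_I]
  have DtX: "Dv p (Y p) (\<lambda>q. F q (t q (X q)))
      = ?\<phi> (Dv p (Y p) (\<lambda>q. F q (X q))) + g (f p) (nabla (f p) (?\<phi> ?y) \<xi>) ?x *\<^sub>R \<xi> (f p)"
    using nabla_along_phi[OF diff[OF sX], of p "Y p"] by (simp add: F_t XD eta_F algebra_simps)
  have DtY: "Dv p (X p) (\<lambda>q. F q (t q (Y q)))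
      = ?\<phi> (Dv p (X p) (\<lambda>q. F q (Y q))) + g (f p) (nabla (f p) (?\<phi> ?x) \<xi>) ?y *\<^sub>R \<xi> (f p)"
    using nabla_along_phi[OF diff[OF sY], of p "X p"] by (simp add: F_t YD eta_F algebra_simps)
  \<comment> \<open>Skewness of \<open>\<phi>\<close> together with \<open>nabla_phi_xi\<close>
    moves \<open>\<phi>\<close> from the second argument of the metric into the direction of
    differentiation, at the cost of a sign.\<close>
  have lie: "lie_deriv_metric A \<xi> g (f p) ?x (?\<phi> ?y)
      = g (f p) (nabla (f p) (?\<phi> ?y) \<xi>) ?x - g (f p) (nabla (f p) (?\<phi> ?x) \<xi>) ?y"
    unfolding M.lie_deriv_metric_xi M.nabla_phi_xi[of _ ?x] M.phi_skew
    using M.metric_sym[of "f p" ?x] by simp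
  \<comment> \<open>Only the second argument of \<open>h\<close> is differentiated, so
    \<open>tX\<close> is moved there before the structure equation is used.\<close>
  have sym: "h (\<lambda>q. t q (X q)) Y p = h Y (\<lambda>q. t q (X q)) p"
    by (rule second_ff_symmetric[OF open_UNIV UNIV_I stX sY])
  have br: "?\<phi> (F p (lie_bracket B X Y p))
      = ?\<phi> (Dv p (X p) (\<lambda>q. F q (Y q))) - ?\<phi> (Dv p (Y p) (\<lambda>q. F q (X q)))"
    by (simp add: linear_diff[OF M.linear_phi] flip: torsion_along[OF open_UNIV UNIV_I sX sY])
  show ?thesis
    unfolding defect_def lie sym br
    unfolding second_ff_eq DtX DtY linear_diff[OF linear_F]
    by (simp add: algebra_simps)
qed

lemma bracket_in_D_iff:
  assumes X: "section_of B D X" and Y: "section_of B D Y"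
  shows "lie_bracket B X Y p \<in> D p \<longleftrightarrow> defect X Y p = 0"
proof
  assume "lie_bracket B X Y p \<in> D p"
  then obtain w where w: "\<phi> (f p) (F p (lie_bracket B X Y p)) = F p w" using phi_D by blast
  \<comment> \<open>With \<open>w\<close> in place, the right-hand side of \<open>defect_eq\<close>
    is the image of a single tangent vector, while \<open>defect\<close> is normal.\<close>
  show "defect X Y p = 0"
    using defect_normal[OF X Y, of p] unfolding defect_eq[OF X Y] w linear_diff[OF linear_F, symmetric]
    by (rule normal_tangent_zero)
next
  assume "defect X Y p = 0"
  define u where "u = nabla' p (X p) (\<lambda>q. t q (Y q)) - nabla' p (Y p) (\<lambda>q. t q (X q))"
  have u: "\<phi> (f p) (F p (lie_bracket B X Y p)) = F p u"
    using defect_eq[OF X Y, of p] \<open>defect X Y p = 0\<close> by (simp add: u_def)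
  obtain a b where ab: "a \<in> D p" "b \<in> D' p" "lie_bracket B X Y p = a + b" using D_sum by blast
  obtain a' where a': "\<phi> (f p) (F p a) = F p a'" using phi_D[OF ab(1)] by blast
  have "\<phi> (f p) (F p b) = F p (u - a')"
    using u a' unfolding ab(3) by (simp add: linear_add[OF linear_F] linear_add[OF M.linear_phi]
        linear_diff[OF linear_F] algebra_simps)
  \<comment> \<open>The vector is tangent by the preceding equation and normal because
    \<open>b \<in> D' p\<close>.\<close>
  then have "\<phi> (f p) (F p b) = 0"
    using phi_D'[OF ab(2)] normal_tangent_zero by simp
  \<comment> \<open>The square of \<open>\<phi>\<close> is \<open>- id\<close> on vectors tangent to
    the submanifold, where \<open>\<eta>\<close> vanishes.\<close>
  then have "F p b = 0"
    using M.phi_phi[of "f p" "F p b"] by (simp add: eta_F linear_0[OF M.linear_phi])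
  then have "b = 0" using inj_F linear_injective_0[OF linear_F] by blast
  with ab show "lie_bracket B X Y p \<in> D p" by simp
qed

text \<open>Brackets of smooth fields are smooth, so for the bracket to be a section of
  \<open>D\<close> is a condition at each point separately.\<close>

lemma integrable_iff:
  "integrable_distribution B D \<longleftrightarrow>
    (\<forall>X Y. section_of B D X \<longrightarrow> section_of B D Y \<longrightarrow> (\<forall>p. defect X Y p = 0))"
  unfolding integrable_distribution_def section_of_def[of B D "lie_bracket B _ _"]
  using bracket_in_D_iff smooth_lie_bracket section_of_def[of B D] by blast

end

theorem theorem2:
  fixes A :: "('m::{t2_space, second_countable_topology}, 'a::euclidean_space) atlas"
    and B :: "('n::{t2_space, second_countable_topology}, 'b::euclidean_space) atlas"
    and \<phi> :: "'m \<Rightarrow> 'a \<Rightarrow> 'a" and \<xi> :: "'m \<Rightarrow> 'a" and \<eta> :: "'m \<Rightarrow> 'a \<Rightarrow> real"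
    and g :: "('m, 'a) metric_tensor" and nabla :: "('m, 'a) conn"
    and f :: "'n \<Rightarrow> 'm" and D D' :: "'n \<Rightarrow> 'b set" and nabla' :: "('n, 'b) conn"
    and n :: nat
  assumes "smooth_atlas A" and "DIM('a) = 2 * n + 1"
    and "generalized_quasi_sasakian A \<phi> \<xi> \<eta> g nabla"
    and "semi_invariant_xi_perp B A f \<phi> \<xi> g D D'"
    and "levi_civita B (induced_metric B A f g) nabla'"
  shows "integrable_distribution B D \<longleftrightarrow>
    (\<forall>X Y. section_of B D X \<longrightarrow> section_of B D Y \<longrightarrow>
       (\<forall>p. second_ff B A f nabla nabla' (\<lambda>q. t_part B A f \<phi> g D q (X q)) Y p
            - second_ff B A f nabla nabla' X (\<lambda>q. t_part B A f \<phi> g D q (Y q)) p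
          = lie_deriv_metric A \<xi> g (f p) (tangent_map B A f p (X p))
              (\<phi> (f p) (tangent_map B A f p (Y p))) *\<^sub>R \<xi> (f p)))"
proof -
  interpret semi_invariant_submanifold B A f \<phi> \<xi> \<eta> g nabla nabla' D D'
    using assms by unfold_locales
      (auto simp: semi_invariant_xi_perp_def immersion_def levi_civita_def)
  show ?thesis unfolding integrable_iff defect_def by simp
qed

end
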